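(* Let $m\ge 1$ be an integer, $\delta\in\mathbb{R}$ and $p,q\in\mathbb{N}=\{0,1,2,\dots\}$ with $p\ge q$. Let $A:\mathcal{S}^p_\delta(\mathbb{R}^m)\to\mathcal{S}^q_\delta(\mathbb{R}^m)$ be a linear map that is $s\ell_{m+1}$-equivariant, i.e. $L_X\circ A=A\circ L_X$ for all $X\in s\ell_{m+1}$. If $A$ is non vanishing, then either $p=q$ and $A$ is a constant multiple of the identity, or $p>q$, $\delta=\frac{m+p+q}{m+1}$ and $A$ is a constant multiple of $T_{p-q}$.
   Context: $s\ell_{m+1}$ denotes the Lie subalgebra of the Lie algebra $Vect(\mathbb{R}^m)$ of smooth vector fields on $\mathbb{R}^m$ spanned by $\partial_i$, $x^j\partial_i$ and $x^jE$ ($1\le i,j\le m$), where $E=\sum_i x^i\partial_i$; it is isomorphic to $s\ell(m+1,\mathbb{R})$. $\mathcal{S}^k_\delta(\mathbb{R}^m)$ is the space of smooth symmetric $k$-contravariant tensor fields on $\mathbb{R}^m$ with values in the $\delta$-densities. It is identified with $C_\infty(\mathbb{R}^m,\vee^k\mathbb{R}^m)$, with Lie derivative $L_XP=X.P-\rho(DX)P+\delta\,\mathrm{tr}(DX)P$, where $X.P=\sum_i X^i\partial_iP$, $DX=(\partial_jX^i)$ and $\rho$ is the natural representation of $g\ell(m,\mathbb{R})$ on $\vee^k\mathbb{R}^m$. Elements of $\vee^k\mathbb{R}^m$ are viewed as homogeneous polynomials of degree $k$ in $\xi=(\xi_1,\dots,\xi_m)\in\mathbb{R}^{m*}$. For $n\in\mathbb{N}$,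 $T_n:\mathcal{S}^{r+n}_\delta(\mathbb{R}^m)\to\mathcal{S}^{r}_\delta(\mathbb{R}^m)$ is the differential operator $$T_nP=\sum_{i_1,\dots,i_n}\partial_{i_1}\cdots\partial_{i_n}D_{\xi_{i_1}}\cdots D_{\xi_{i_n}}P,$$ where $\partial_i$ is the partial derivative with respect to $x^i$ and $D_{\xi_i}$ the partial derivative with respect to $\xi_i$. No continuity or locality is assumed of linear maps. *)

theory Defs
  imports "HOL-Analysis.Analysis" "HOL-Library.Function_Algebras"
begin

definition pderiv_at :: "'m::finite \<Rightarrow> (real^'m \<Rightarrow> real) \<Rightarrow> real^'m \<Rightarrow> real" where
  "pderiv_at i f x = frechet_derivative f (at x) (axis i 1)"

(* C_infinity on the whole space: every iterated partial derivative exists and is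
   differentiable, hence continuous.  The value of frechet_derivative at points of
   non-differentiability never matters, since the condition for a list of indices is
   accompanied by the condition for all of its tails. *)
definition smooth :: "(real^'m::finite \<Rightarrow> real) \<Rightarrow> bool" where
  "smooth f \<longleftrightarrow> (\<forall>is :: 'm list. \<forall>x. foldr pderiv_at is f differentiable (at x))"

(* A tensor field is a function P of the point x and of the covector xi (given by its
   components); for fixed x it is a homogeneous polynomial of degree k in xi, and its
   coefficients, indexed by the multi-indices of length k, are smooth functions of x.
   The symmetric product of vectors v_1, ..., v_k corresponds to the product of the
   linear forms xi |-> v_l \<bullet> xi. *)
type_synonym 'm tensor_field = "real^'m \<Rightarrow> real^'m \<Rightarrow> real"

definition sym_tensor_fields :: "nat \<Rightarrow> 'm::finite tensor_field set" where
  "sym_tensor_fields k =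
     {P. \<exists>c :: ('m \<Rightarrow> nat) \<Rightarrow> real^'m \<Rightarrow> real. (\<forall>\<alpha>. smooth (c \<alpha>)) \<and>
        (\<forall>x \<xi>. P x \<xi> = (\<Sum>\<alpha> | sum \<alpha> UNIV = k. c \<alpha> x * (\<Prod>i\<in>UNIV. (\<xi>$i) ^ \<alpha> i)))}"

lemma finite_multi_indices: "finite {\<alpha> :: 'm::finite \<Rightarrow> nat. sum \<alpha> UNIV = k}"
proof (rule finite_subset)
  show "{\<alpha> :: 'm \<Rightarrow> nat. sum \<alpha> UNIV = k} \<subseteq> PiE UNIV (\<lambda>_. {..k})"
    by (auto simp: member_le_sum)
qed (auto intro: finite_PiE)

definition dx :: "'m::finite \<Rightarrow> 'm tensor_field \<Rightarrow> 'm tensor_field" where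
  "dx i P = (\<lambda>x \<xi>. pderiv_at i (\<lambda>y. P y \<xi>) x)"

definition dxi :: "'m::finite \<Rightarrow> 'm tensor_field \<Rightarrow> 'm tensor_field" where
  "dxi i P = (\<lambda>x \<xi>. pderiv_at i (P x) \<xi>)"

(* The natural representation of gl(m) on the symmetric algebra is by derivations extending
   e_j |-> M e_j.  Since e_j is the polynomial xi_j, this is
   sum_{i,j} M^i_j xi_i D_{xi_j}; compare rho_prod_linear_forms below. *)
definition rho :: "real^'m^'m::finite \<Rightarrow> (real^'m \<Rightarrow> real) \<Rightarrow> real^'m \<Rightarrow> real" where
  "rho M p \<xi> = (\<Sum>i\<in>UNIV. \<Sum>j\<in>UNIV. M$i$j * \<xi>$i * pderiv_at j p \<xi>)"

definition jacobian :: "(real^'m::finite \<Rightarrow> real^'m) \<Rightarrow> real^'m \<Rightarrow> real^'m^'m" where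
  "jacobian X x = (\<chi> i j. pderiv_at j (\<lambda>y. X y $ i) x)"

definition lie_deriv ::
    "real \<Rightarrow> (real^'m::finite \<Rightarrow> real^'m) \<Rightarrow> 'm tensor_field \<Rightarrow> 'm tensor_field" where
  "lie_deriv \<delta> X P = (\<lambda>x \<xi>. (\<Sum>i\<in>UNIV. X x $ i * dx i P x \<xi>)
      - rho (jacobian X x) (P x) \<xi> + \<delta> * trace (jacobian X x) * P x \<xi>)"

definition vf_scale :: "real \<Rightarrow> (real^'m::finite \<Rightarrow> real^'m) \<Rightarrow> real^'m \<Rightarrow> real^'m" where
  "vf_scale c X = (\<lambda>x. c *\<^sub>R X x)"

interpretation vf: vector_space "vf_scale :: real \<Rightarrow> (real^'m::finite \<Rightarrow> real^'m) \<Rightarrow> _"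
  by unfold_locales (auto simp: vf_scale_def fun_eq_iff algebra_simps)

(* The Euler field is the identity map x |-> x. *)
definition sl_fields :: "(real^'m::finite \<Rightarrow> real^'m) set" where
  "sl_fields = vf.span
     (range (\<lambda>i x. axis i 1) \<union>
      range (\<lambda>(i, j) x. x$j *\<^sub>R axis i 1) \<union>
      range (\<lambda>j x. x$j *\<^sub>R x))"

definition linear_between ::
    "'m::finite tensor_field set \<Rightarrow> 'm tensor_field set \<Rightarrow>
     ('m tensor_field \<Rightarrow> 'm tensor_field) \<Rightarrow> bool" where
  "linear_between V W A \<longleftrightarrow>
     (\<forall>P\<in>V. A P \<in> W) \<and>
     (\<forall>P\<in>V. \<forall>Q\<in>V. A (\<lambda>x \<xi>. P x \<xi> + Q x \<xi>) = (\<lambda>x \<xi>. A P x \<xi> + A Q x \<xi>)) \<and>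
     (\<forall>c. \<forall>P\<in>V. A (\<lambda>x \<xi>. c * P x \<xi>) = (\<lambda>x \<xi>. c * A P x \<xi>))"

definition T_op :: "nat \<Rightarrow> 'm::finite tensor_field \<Rightarrow> 'm tensor_field" where
  "T_op n P = (\<lambda>x \<xi>. \<Sum>is | length is = n. foldr dx is (foldr dxi is P) x \<xi>)"

lemma rho_prod_linear_forms:
  fixes M :: "real^'m^'m::finite" and v :: "'l \<Rightarrow> real^'m"
  assumes "finite I"
  shows "rho M (\<lambda>\<xi>. \<Prod>l\<in>I. v l \<bullet> \<xi>) \<xi> =
    (\<Sum>l\<in>I. ((M *v v l) \<bullet> \<xi>) * (\<Prod>l'\<in>I - {l}. v l' \<bullet> \<xi>))"
proof -
  have "((\<lambda>\<xi>. \<Prod>l\<in>I. v l \<bullet> \<xi>) has_derivative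
      (\<lambda>h. \<Sum>l\<in>I. (v l \<bullet> h) * (\<Prod>l'\<in>I - {l}. v l' \<bullet> \<xi>))) (at \<xi>)"
    by (rule has_derivative_prod) (auto intro!: derivative_eq_intros)
  then have pd: "pderiv_at j (\<lambda>\<xi>. \<Prod>l\<in>I. v l \<bullet> \<xi>) \<xi> =
      (\<Sum>l\<in>I. v l $ j * (\<Prod>l'\<in>I - {l}. v l' \<bullet> \<xi>))" for j
    unfolding pderiv_at_def by (simp add: frechet_derivative_at[symmetric] inner_axis)
  have lin: "(M *v w) \<bullet> \<xi> = (\<Sum>i\<in>UNIV. \<Sum>j\<in>UNIV. M$i$j * \<xi>$i * w$j)" for w
    by (simp add: matrix_vector_mult_def inner_vec_def sum_distrib_left sum_distrib_right mult_ac)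
  have "rho M (\<lambda>\<xi>. \<Prod>l\<in>I. v l \<bullet> \<xi>) \<xi> =
      (\<Sum>i\<in>UNIV. \<Sum>j\<in>UNIV. \<Sum>l\<in>I. M$i$j * \<xi>$i * v l $ j * (\<Prod>l'\<in>I - {l}. v l' \<bullet> \<xi>))"
    unfolding rho_def pd by (simp add: sum_distrib_left mult.assoc)
  also have "\<dots> = (\<Sum>l\<in>I. \<Sum>i\<in>UNIV. \<Sum>j\<in>UNIV. M$i$j * \<xi>$i * v l $ j * (\<Prod>l'\<in>I - {l}. v l' \<bullet> \<xi>))"
    by (simp only: sum.swap[of _ I])
  also have "\<dots> = (\<Sum>l\<in>I. ((M *v v l) \<bullet> \<xi>) * (\<Prod>l'\<in>I - {l}. v l' \<bullet> \<xi>))"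
    unfolding lin by (simp add: sum_distrib_right)
  finally show ?thesis .
qed

end

(* Write n = p - q and fix a point a.  The fields (x_i - a_i) \<partial>_i are in the algebra, and adding up
   their equivariance relations at a gives A (((x - a) \<cdot> \<partial> - n) Q \<xi>^\<beta>) (a) = 0 for every smooth Q.
   Integration along the rays from a shows that every smooth function is, modulo the image of
   (x - a) \<cdot> \<partial> - n, the homogeneous part of degree n of its Taylor polynomial at a.  Hence A is local
   without any continuity assumption: A P (a) depends only on the n-th derivatives of P at a, through
   a gl(m)-equivariant map.  Such a map is determined by its value at (x_o - a_o)^n \<xi>_o^p, which is a
   multiple of \<xi>_o^q by a weight argument, so it is a multiple c of the contraction.  Equivariance under
   translations makes c independent of a, and the quadratic field x_o E, applied to x_o^(n-1) \<xi>_o^p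
   at the origin, yields the condition on \<delta> when n > 0. *)
theory Submission
  imports Defs
begin

section \<open>Smooth functions\<close>

text \<open>Since \<open>A\<close> is merely linear, a Taylor remainder cannot be discarded by a
  limit or a cut-off; it has to lie exactly in the image of (x - a) \<cdot> \<partial> - n on smooth
  functions. Solving ((x - a) \<cdot> \<partial> - n) Q = f by a single integral would need the
  weight t^(-n-1) along the ray, which is singular at t = 0. Hadamard's lemma avoids this: write f =
  f(a) + sum of (x_j - a_j) g_j. On (x_j - a_j) R the operator with n + 1 is (x_j - a_j) times the
  operator with n on R, so n drops by one at each stage and only integrals with weights t^k, k \<ge>
  0, occur. The fields used at a point are those vanishing there: their Lie derivative at that point
  contains no x-derivative of the unknown field \<open>A P\<close>. For the linear ones the
  divergence terms on the two sides cancel, so they carry no information on \<delta>. The quadratic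
  fields vanish to second order at the origin; there the side of the equation with
  \<open>A P\<close> disappears altogether, while the divergence survives inside the argument of
  \<open>A\<close>.\<close>

lemma pderiv_at_eqI: "(f has_derivative f') (at x) \<Longrightarrow> pderiv_at i f x = f' (axis i 1)"
  unfolding pderiv_at_def by (metis frechet_derivative_at)

lemma has_derivative_pderiv_at:
  fixes f :: "real^'m::finite \<Rightarrow> real"
  assumes "f differentiable (at x)"
  shows "(f has_derivative (\<lambda>h. \<Sum>i\<in>UNIV. h$i * pderiv_at i f x)) (at x)"
proof -
  let ?D = "frechet_derivative f (at x)"
  have D: "(f has_derivative ?D) (at x)"
    using assms frechet_derivative_works by blast
  then have lin: "linear ?D"
    by (rule has_derivative_linear)
  have "?D h = (\<Sum>i\<in>UNIV. h$i * pderiv_at i f x)" for h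
  proof -
    have "?D h = ?D (\<Sum>i\<in>UNIV. h$i *s axis i 1)"
      by (simp add: basis_expansion)
    also have "\<dots> = (\<Sum>i\<in>UNIV. h$i * pderiv_at i f x)"
      unfolding linear_sum[OF lin] pderiv_at_def scalar_mult_eq_scaleR
      by (simp add: linear_cmul[OF lin])
    finally show ?thesis .
  qed
  then have "?D = (\<lambda>h. \<Sum>i\<in>UNIV. h$i * pderiv_at i f x)"
    by blast
  with D show ?thesis by simp
qed

lemma pderiv_at_const [simp]: "pderiv_at i (\<lambda>x. c) x = 0"
  by (subst pderiv_at_eqI[OF has_derivative_const]) simp

lemma pderiv_at_const_fun [simp]: "pderiv_at i (\<lambda>x. c) = (\<lambda>x. 0)"
  by (rule ext) simp

lemma pderiv_at_add:
  "f differentiable (at x) \<Longrightarrow> g differentiable (at x) \<Longrightarrow>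
    pderiv_at i (\<lambda>x. f x + g x) x = pderiv_at i f x + pderiv_at i g x"
  by (subst pderiv_at_eqI[OF has_derivative_add[OF has_derivative_pderiv_at has_derivative_pderiv_at]])
    (auto simp: axis_def if_distrib[of "\<lambda>x. x * _"] cong: if_cong)

lemma pderiv_at_mult:
  "f differentiable (at x) \<Longrightarrow> g differentiable (at x) \<Longrightarrow>
    pderiv_at i (\<lambda>x. f x * g x) x = f x * pderiv_at i g x + pderiv_at i f x * g x"
  by (subst pderiv_at_eqI[OF has_derivative_mult[OF has_derivative_pderiv_at has_derivative_pderiv_at]])
    (auto simp: axis_def if_distrib[of "\<lambda>x. x * _"] cong: if_cong)

lemma pderiv_at_cmult:
  "f differentiable (at x) \<Longrightarrow> pderiv_at i (\<lambda>x. c * f x) x = c * pderiv_at i f x"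
  by (subst pderiv_at_mult) auto

lemma pderiv_at_sum:
  "(\<And>l. l \<in> L \<Longrightarrow> f l differentiable (at x)) \<Longrightarrow>
    pderiv_at i (\<lambda>x. \<Sum>l\<in>L. f l x) x = (\<Sum>l\<in>L. pderiv_at i (f l) x)"
  by (subst pderiv_at_eqI[OF has_derivative_sum[OF has_derivative_pderiv_at]])
    (auto simp: axis_def if_distrib[of "\<lambda>x. x * _"] cong: if_cong)

lemma pderiv_at_nth [simp]:
  "pderiv_at i (\<lambda>x. x$j - b) x = (if i = j then 1 else 0)"
  "pderiv_at i (\<lambda>x. x$j) x = (if i = j then 1 else 0)"
  by (subst pderiv_at_eqI[where f' = "\<lambda>h. h$j"];
      auto intro!: derivative_eq_intros bounded_linear_imp_has_derivative simp: axis_def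
        bounded_linear_vec_nth)+

lemma differentiable_nth [simp, intro]: "(\<lambda>x. x$j) differentiable (at x)"
  by (rule bounded_linear_imp_differentiable) (rule bounded_linear_vec_nth)

lemma differentiable_sum_fun:
  "(\<And>l. l \<in> L \<Longrightarrow> f l differentiable (at x)) \<Longrightarrow>
    finite L \<Longrightarrow> (\<lambda>x. \<Sum>l\<in>L. f l x) differentiable (at x)"
  by (rule differentiable_sum) auto

lemma smooth_differentiable: "smooth f \<Longrightarrow> f differentiable (at x)"
  unfolding smooth_def by (metis foldr.simps(1) id_apply)

lemma smooth_pderiv_at: "smooth f \<Longrightarrow> smooth (pderiv_at i f)"
proof -
  assume f: "smooth f"
  have "foldr pderiv_at is (pderiv_at i f) = foldr pderiv_at (is @ [i]) f" for "is"
    by simp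
  then show ?thesis using f unfolding smooth_def by metis
qed

lemma smooth_foldr_pderiv_at: "smooth f \<Longrightarrow> smooth (foldr pderiv_at is f)"
  by (induction "is") (auto intro: smooth_pderiv_at)

text \<open>Spares any computation of iterated derivatives: it is enough to exhibit a class of
  differentiable functions that one partial derivative does not leave.\<close>

lemma smooth_coinduct:
  assumes "S f"
    and diff: "\<And>g x. S g \<Longrightarrow> g differentiable (at x)"
    and step: "\<And>g i. S g \<Longrightarrow> S (pderiv_at i g)"
  shows "smooth f"
proof -
  have "S (foldr pderiv_at is f)" for "is"
    by (induction "is") (auto intro: assms)
  then show ?thesis unfolding smooth_def by (auto intro: diff)
qed

text \<open>Unlike the set of products, the algebra generated by the smooth functions is visibly stable under
  partial derivatives.\<close>

inductive smooth_alg :: "(real^'m::finite \<Rightarrow> real) \<Rightarrow> bool" where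
  base: "smooth f \<Longrightarrow> smooth_alg f"
| add: "smooth_alg f \<Longrightarrow> smooth_alg g \<Longrightarrow> smooth_alg (\<lambda>x. f x + g x)"
| mult: "smooth_alg f \<Longrightarrow> smooth_alg g \<Longrightarrow> smooth_alg (\<lambda>x. f x * g x)"

lemma smooth_alg_imp_smooth:
  fixes f :: "real^'m::finite \<Rightarrow> real"
  assumes "smooth_alg f"
  shows "smooth f"
proof -
  have diff: "g differentiable (at x)" if "smooth_alg g" for g :: "real^'m::finite \<Rightarrow> real" and x
    using that by induction (auto simp: smooth_differentiable)
  have "smooth_alg (pderiv_at i g)" if "smooth_alg g" for g :: "real^'m::finite \<Rightarrow> real" and i
    using that
  proof induction
    case (base f)
    then show ?case by (intro smooth_alg.base smooth_pderiv_at)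
  next
    case (add f g)
    then have "pderiv_at i (\<lambda>x. f x + g x) = (\<lambda>x. pderiv_at i f x + pderiv_at i g x)"
      by (intro ext pderiv_at_add) (auto intro: diff)
    with add show ?case by (auto intro: smooth_alg.intros)
  next
    case (mult f g)
    then have "pderiv_at i (\<lambda>x. f x * g x) = (\<lambda>x. f x * pderiv_at i g x + pderiv_at i f x * g x)"
      by (intro ext pderiv_at_mult) (auto intro: diff)
    with mult show ?case by (auto intro!: smooth_alg.add smooth_alg.mult)
  qed
  with assms diff show ?thesis
    by (rule_tac smooth_coinduct[where S = smooth_alg])
qed

lemma smooth_add: "smooth f \<Longrightarrow> smooth g \<Longrightarrow> smooth (\<lambda>x. f x + g x)"
  by (auto intro: smooth_alg_imp_smooth smooth_alg.intros)

lemma smooth_mult: "smooth f \<Longrightarrow> smooth g \<Longrightarrow> smooth (\<lambda>x. f x * g x)"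
  by (auto intro: smooth_alg_imp_smooth smooth_alg.intros)

lemma smooth_const [simp]: "smooth (\<lambda>x. c)"
  by (rule smooth_coinduct[where S = "\<lambda>f. \<exists>c. f = (\<lambda>x. c)"])
    auto

lemma smooth_sum:
  "(\<And>l. l \<in> L \<Longrightarrow> smooth (f l)) \<Longrightarrow> smooth (\<lambda>x. \<Sum>l\<in>L. f l x)"
  by (induction L rule: infinite_finite_induct) (auto intro: smooth_add)

lemma smooth_prod:
  "(\<And>l. l \<in> L \<Longrightarrow> smooth (f l)) \<Longrightarrow> smooth (\<lambda>x. \<Prod>l\<in>L. f l x)"
  by (induction L rule: infinite_finite_induct) (auto intro: smooth_mult)

lemma smooth_power: "smooth f \<Longrightarrow> smooth (\<lambda>x. f x ^ n)"
  by (induction n) (auto intro: smooth_mult)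

lemma smooth_nth [simp]: "smooth (\<lambda>x. x$j)"
proof (rule smooth_coinduct[where S = "\<lambda>f. f = (\<lambda>x. x$j) \<or> (\<exists>c. f = (\<lambda>x. c))"])
  fix g :: "(real, 'a) vec \<Rightarrow> real" and i
  assume "g = (\<lambda>x. x$j) \<or> (\<exists>c. g = (\<lambda>x. c))"
  then show "pderiv_at i g = (\<lambda>x. x$j) \<or> (\<exists>c. pderiv_at i g = (\<lambda>x. c))"
  proof
    assume "g = (\<lambda>x. x$j)"
    then have "pderiv_at i g = (\<lambda>x. if i = j then 1 else 0)"
      by (intro ext) simp
    then show ?thesis by blast
  qed auto
qed auto

lemma smooth_nth_diff [simp]: "smooth (\<lambda>x. x$j - b)"
  using smooth_add[OF smooth_nth smooth_const[of "-b"]] by simp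

lemma smooth_continuous_on: "smooth f \<Longrightarrow> continuous_on S f"
  by (meson continuous_at_imp_continuous_on differentiable_imp_continuous_within smooth_differentiable)

section \<open>Taylor expansion modulo the Euler operator\<close>

text \<open>The weight t^k makes the family stable under differentiation: each partial derivative in
  \<open>x\<close> brings out one more factor t by the chain rule.\<close>

definition ray_int :: "real^'m::finite \<Rightarrow> nat \<Rightarrow> (real^'m \<Rightarrow> real) \<Rightarrow> real^'m \<Rightarrow> real" where
  "ray_int a k g x = integral {0..1} (\<lambda>t. t^k * g (a + t *\<^sub>R (x - a)))"

lemma has_derivative_inner_gradient:
  assumes "smooth g"
  shows "(g has_derivative (\<lambda>h. h \<bullet> (\<chi> i. pderiv_at i g x))) (at x)"
  using has_derivative_pderiv_at[OF smooth_differentiable[OF assms]]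
  by (simp add: inner_vec_def)

lemma ray_integrable:
  assumes "smooth g"
  shows "(\<lambda>t. t^k * g (a + t *\<^sub>R (x - a))) integrable_on {0..1}"
  by (intro integrable_continuous_interval continuous_intros
      continuous_on_compose2[OF smooth_continuous_on[OF assms, of UNIV]]) auto

text \<open>Differentiation under the integral sign. The gradient is packed into a bounded linear
  function because \<open>leibniz_rule\<close> asks for a derivative that is jointly continuous in
  that sense.\<close>

lemma ray_int_has_derivative:
  fixes g :: "real^'m::finite \<Rightarrow> real"
  assumes g: "smooth g"
  shows "(ray_int a k g has_derivative (\<lambda>h. \<Sum>i\<in>UNIV. h$i * ray_int a (Suc k) (pderiv_at i g) x)) (at x)"
proof -
  let ?G = "\<lambda>x. \<chi> i. pderiv_at i g x"
  \<comment> \<open>The factor t^k is the weight; the separate factor t comes from the chain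
    rule.\<close>
  let ?fx = "\<lambda>x t. t^k *\<^sub>R t *\<^sub>R blinfun_inner_left (?G (a + t *\<^sub>R (x - a)))"
  have contG: "continuous_on UNIV ?G"
    by (intro continuous_on_vec_lambda smooth_continuous_on smooth_pderiv_at g)
  have cont: "continuous_on (UNIV \<times> cbox 0 1) (\<lambda>(x, t). ?fx x t)"
    unfolding split_beta
    by (intro continuous_intros continuous_on_compose2[OF contG]
        bounded_linear.continuous_on[OF bounded_linear_blinfun_inner_left]) auto
  have "((\<lambda>x. integral (cbox 0 1) (\<lambda>t. t^k * g (a + t *\<^sub>R (x - a)))) has_derivative
      integral (cbox 0 1) (?fx x)) (at x within UNIV)"
  proof (rule leibniz_rule)
    fix x t
    have "((\<lambda>x. g (a + t *\<^sub>R (x - a))) has_derivative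
        (\<lambda>h. (t *\<^sub>R h) \<bullet> ?G (a + t *\<^sub>R (x - a)))) (at x)"
      by (rule has_derivative_compose[OF _ has_derivative_inner_gradient[OF g]])
        (auto intro!: derivative_eq_intros)
    then have "((\<lambda>x. t^k * g (a + t *\<^sub>R (x - a))) has_derivative
        (\<lambda>h. t^k * ((t *\<^sub>R h) \<bullet> ?G (a + t *\<^sub>R (x - a))))) (at x)"
      by (rule has_derivative_mult_right)
    moreover have "blinfun_apply (?fx x t) = (\<lambda>h. t^k * ((t *\<^sub>R h) \<bullet> ?G (a + t *\<^sub>R (x - a))))"
      by (rule ext) (simp add: blinfun.scaleR_left)
    ultimately show "((\<lambda>x. t^k * g (a + t *\<^sub>R (x - a))) has_derivative ?fx x t) (at x within UNIV)"
      by simp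
  next
    show "(\<lambda>t. t^k * g (a + t *\<^sub>R (x - a))) integrable_on cbox 0 1" for x
      using ray_integrable[OF g] by simp
  qed (use cont in auto)
  moreover have "integral (cbox 0 1) (?fx x) h = (\<Sum>i\<in>UNIV. h$i * ray_int a (Suc k) (pderiv_at i g) x)" for h
  proof -
    have "continuous_on (cbox 0 1) (?fx x)"
      by (intro continuous_intros continuous_on_compose2[OF contG]
        bounded_linear.continuous_on[OF bounded_linear_blinfun_inner_left]) auto
    then have int: "?fx x integrable_on cbox 0 1"
      by (rule integrable_continuous)
    have "integral (cbox 0 1) (?fx x) h = integral (cbox 0 1) (\<lambda>t. ?fx x t h)"
      by (rule blinfun_apply_integral[OF int])
    also have "\<dots> = integral {0..1} (\<lambda>t. \<Sum>i\<in>UNIV. h$i * (t^Suc k * pderiv_at i g (a + t *\<^sub>R (x - a))))"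
      by (simp add: blinfun.bilinear_simps inner_vec_def sum_distrib_left mult_ac)
    also have "\<dots> = (\<Sum>i\<in>UNIV. integral {0..1} (\<lambda>t. h$i * (t^Suc k * pderiv_at i g (a + t *\<^sub>R (x - a)))))"
      by (rule integral_sum) (auto intro!: integrable_on_mult_right ray_integrable smooth_pderiv_at g simp del: power_Suc)
    finally show ?thesis
      unfolding ray_int_def by simp
  qed
  then have "blinfun_apply (integral (cbox 0 1) (?fx x)) =
      (\<lambda>h. \<Sum>i\<in>UNIV. h$i * ray_int a (Suc k) (pderiv_at i g) x)"
    by (rule ext)
  moreover have "ray_int a k g = (\<lambda>x. integral (cbox 0 1) (\<lambda>t. t^k * g (a + t *\<^sub>R (x - a))))"
    by (rule ext) (simp add: ray_int_def)
  ultimately show ?thesis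
    by (simp only:)
qed

lemma pderiv_at_ray_int:
  "smooth g \<Longrightarrow> pderiv_at i (ray_int a k g) = ray_int a (Suc k) (pderiv_at i g)"
  by (rule ext, subst pderiv_at_eqI[OF ray_int_has_derivative])
    (auto simp: axis_def if_distrib[of "\<lambda>x. x * _"] cong: if_cong)

lemma smooth_ray_int:
  assumes "smooth g"
  shows "smooth (ray_int a k g)"
proof (rule smooth_coinduct[where S = "\<lambda>f. \<exists>k g. smooth g \<and> f = ray_int a k g"])
  show "f differentiable (at x)" if "\<exists>k g. smooth g \<and> f = ray_int a k g" for f x
    using that ray_int_has_derivative unfolding differentiable_def by blast
  show "\<exists>k g. smooth g \<and> pderiv_at i f = ray_int a k g" if "\<exists>k g. smooth g \<and> f = ray_int a k g" for f i
    using that pderiv_at_ray_int smooth_pderiv_at by metis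
qed (use assms in blast)

lemma foldr_pderiv_at_ray_int:
  "smooth g \<Longrightarrow> foldr pderiv_at is (ray_int a k g) = ray_int a (length is + k) (foldr pderiv_at is g)"
  by (induction "is") (auto simp: pderiv_at_ray_int smooth_foldr_pderiv_at)

text \<open>At the centre the ray is constant. Together with \<open>foldr_pderiv_at_ray_int\<close>
  this yields the factor 1/(n+1) that turns \<open>fact n\<close> into \<open>fact (Suc n)\<close>
  in the Taylor sum.\<close>

lemma ray_int_center: "ray_int a k g a = g a / (real k + 1)"
proof -
  have "ray_int a k g a = integral {0..1} (\<lambda>t. t^k) * g a"
    by (simp add: ray_int_def)
  also have "integral {0..1} (\<lambda>t::real. t^k) = 1 / (real k + 1)"
  proof (rule integral_unique)
    have "((\<lambda>t::real. t^k) has_integral (1 ^ Suc k / real (Suc k) - 0 ^ Suc k / real (Suc k))) {0..1}"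
      by (rule fundamental_theorem_of_calculus)
        (auto intro!: derivative_eq_intros simp: has_real_derivative_iff_has_vector_derivative[symmetric] simp del: power_Suc of_nat_Suc simp flip: of_nat_Suc)
    then show "((\<lambda>t::real. t^k) has_integral (1 / (real k + 1))) {0..1}" by (simp add: add.commute)
  qed
  finally show ?thesis by simp
qed

lemma ray_has_real_derivative:
  assumes g: "smooth g"
  shows "((\<lambda>t. g (a + t *\<^sub>R (x - a))) has_real_derivative
    (\<Sum>i\<in>UNIV. (x$i - a$i) * pderiv_at i g (a + t *\<^sub>R (x - a)))) (at t within S)"
proof -
  have "((\<lambda>t. g (a + t *\<^sub>R (x - a))) has_derivative
      (\<lambda>s. (s *\<^sub>R (x - a)) \<bullet> (\<chi> i. pderiv_at i g (a + t *\<^sub>R (x - a))))) (at t within S)"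
    by (rule has_derivative_compose[OF _ has_derivative_inner_gradient[OF g]])
      (auto intro!: derivative_eq_intros)
  moreover have "(\<lambda>s. (s *\<^sub>R (x - a)) \<bullet> (\<chi> i. pderiv_at i g (a + t *\<^sub>R (x - a)))) =
      (*) (\<Sum>i\<in>UNIV. (x$i - a$i) * pderiv_at i g (a + t *\<^sub>R (x - a)))"
    by (rule ext) (simp add: inner_vec_def sum_distrib_left sum_distrib_right mult_ac)
  ultimately show ?thesis
    by (simp only: has_field_derivative_def)
qed

text \<open>Hadamard's lemma: integrate the derivative of \<open>g\<close> along the segment from
  \<open>a\<close> to \<open>x\<close>.\<close>

lemma hadamard_ray_int:
  assumes g: "smooth g"
  shows "g x = g a + (\<Sum>i\<in>UNIV. (x$i - a$i) * ray_int a 0 (pderiv_at i g) x)"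
proof -
  have "((\<lambda>t. \<Sum>i\<in>UNIV. (x$i - a$i) * (t^0 * pderiv_at i g (a + t *\<^sub>R (x - a)))) has_integral
      g (a + 1 *\<^sub>R (x - a)) - g (a + 0 *\<^sub>R (x - a))) {0..1}"
    using ray_has_real_derivative[OF g]
    by (intro fundamental_theorem_of_calculus)
      (auto simp: has_real_derivative_iff_has_vector_derivative[symmetric])
  then have "g x - g a = integral {0..1} (\<lambda>t. \<Sum>i\<in>UNIV. (x$i - a$i) * (t^0 * pderiv_at i g (a + t *\<^sub>R (x - a))))"
    by (simp add: integral_unique)
  also have "\<dots> = (\<Sum>i\<in>UNIV. integral {0..1} (\<lambda>t. (x$i - a$i) * (t^0 * pderiv_at i g (a + t *\<^sub>R (x - a)))))"
    by (rule integral_sum) (auto intro!: integrable_on_mult_right ray_integrable smooth_pderiv_at g simp del: power_0)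
  finally show ?thesis
    unfolding ray_int_def by simp
qed

text \<open>Integrating the derivative of t * g (a + t (x - a)) over [0,1] shows that averaging
  along rays is a right inverse of the Euler operator about \<open>a\<close> plus the
  identity.\<close>

lemma euler_ray_int:
  assumes g: "smooth g"
  shows "(\<Sum>i\<in>UNIV. (x$i - a$i) * pderiv_at i (ray_int a 0 g) x) + ray_int a 0 g x = g x"
proof -
  have der: "((\<lambda>t. t * g (a + t *\<^sub>R (x - a))) has_real_derivative
    (t^0 * g (a + t *\<^sub>R (x - a)) + (\<Sum>i\<in>UNIV. (x$i - a$i) * (t^1 * pderiv_at i g (a + t *\<^sub>R (x - a)))))) (at t within S)" for t S
    by (rule derivative_eq_intros ray_has_real_derivative[OF g] refl)+
      (simp add: sum_distrib_left sum_distrib_right mult_ac)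
  have "((\<lambda>t. t^0 * g (a + t *\<^sub>R (x - a)) + (\<Sum>i\<in>UNIV. (x$i - a$i) * (t^1 * pderiv_at i g (a + t *\<^sub>R (x - a))))) has_integral
      1 * g (a + 1 *\<^sub>R (x - a)) - 0 * g (a + 0 *\<^sub>R (x - a))) {0..1}"
    using der by (intro fundamental_theorem_of_calculus)
      (auto simp: has_real_derivative_iff_has_vector_derivative[symmetric])
  then have "g x = integral {0..1} (\<lambda>t. t^0 * g (a + t *\<^sub>R (x - a)) + (\<Sum>i\<in>UNIV. (x$i - a$i) * (t^1 * pderiv_at i g (a + t *\<^sub>R (x - a)))))"
    by (simp add: integral_unique)
  also have "\<dots> = integral {0..1} (\<lambda>t. t^0 * g (a + t *\<^sub>R (x - a))) + integral {0..1} (\<lambda>t. \<Sum>i\<in>UNIV. (x$i - a$i) * (t^1 * pderiv_at i g (a + t *\<^sub>R (x - a))))"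
    by (intro integral_add integrable_sum integrable_on_mult_right ray_integrable smooth_pderiv_at g) auto
  also have "integral {0..1} (\<lambda>t. \<Sum>i\<in>UNIV. (x$i - a$i) * (t^1 * pderiv_at i g (a + t *\<^sub>R (x - a)))) = (\<Sum>i\<in>UNIV. integral {0..1} (\<lambda>t. (x$i - a$i) * (t^1 * pderiv_at i g (a + t *\<^sub>R (x - a)))))"
    by (intro integral_sum integrable_on_mult_right ray_integrable smooth_pderiv_at g) auto
  finally show ?thesis
    using g by (simp add: pderiv_at_ray_int) (simp add: ray_int_def)
qed

text \<open>The last index is split off rather than the head because \<open>foldr\<close> applies
  the last derivative first; it is the one that passes from \<open>f\<close> to its Hadamard
  quotient.\<close>

lemma sum_lists_Suc:
  fixes f :: "'m::finite list \<Rightarrow> 'b::comm_monoid_add"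
  shows "(\<Sum>is | length is = Suc n. f is) = (\<Sum>is | length is = n. \<Sum>i\<in>UNIV. f (is @ [i]))"
proof -
  have "(\<Sum>is | length is = n. \<Sum>i\<in>UNIV. f (is @ [i])) = (\<Sum>(is, i) \<in> {is. length is = n} \<times> UNIV. f (is @ [i]))"
    by (rule sum.cartesian_product)
  also have "\<dots> = (\<Sum>is | length is = Suc n. f is)"
  proof -
    have [simp]: "butlast is @ [last is] = is" if "length is = Suc n" for "is" :: "'m list"
      using that by (metis append_butlast_last_id length_0_conv nat.distinct(1))
    show ?thesis
      by (rule sum.reindex_bij_witness[where j = "\<lambda>(is, i). is @ [i]" and i = "\<lambda>is. (butlast is, last is)"])
        auto
  qed
  finally show ?thesis by simp
qed

text \<open>Leibniz rule: a coordinate x_j - a_j is an eigenfunction of the Euler operator with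
  eigenvalue 1. The additive constant is invisible to the operator and is kept free for adjusting
  the value at \<open>a\<close>.\<close>

lemma euler_sum_nth_mult:
  assumes "\<And>j. smooth (R j)"
  shows "(\<Sum>i\<in>UNIV. (x$i - a$i) * pderiv_at i (\<lambda>x. (\<Sum>j\<in>UNIV. (x$j - a$j) * R j x) + c) x) =
    (\<Sum>j\<in>UNIV. (x$j - a$j) * ((\<Sum>i\<in>UNIV. (x$i - a$i) * pderiv_at i (R j) x) + R j x))"
proof -
  note d = smooth_differentiable[OF assms]
  define y where "y = x - a"
  have pd: "pderiv_at i (\<lambda>x. (\<Sum>j\<in>UNIV. (x$j - a$j) * R j x) + c) x =
      (\<Sum>j\<in>UNIV. y$j * pderiv_at i (R j) x + (if i = j then R j x else 0))" for i
  proof -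
    have "pderiv_at i (\<lambda>x. (\<Sum>j\<in>UNIV. (x$j - a$j) * R j x) + c) x =
        (\<Sum>j\<in>UNIV. pderiv_at i (\<lambda>x. (x$j - a$j) * R j x) x)"
      by (subst pderiv_at_add) (auto simp: pderiv_at_sum d intro!: differentiable_sum_fun d)
    also have "\<dots> = (\<Sum>j\<in>UNIV. y$j * pderiv_at i (R j) x + (if i = j then R j x else 0))"
      by (rule sum.cong) (auto simp: pderiv_at_mult d y_def)
    finally show ?thesis .
  qed
  have "(\<Sum>i\<in>UNIV. y$i * (\<Sum>j\<in>UNIV. y$j * pderiv_at i (R j) x + (if i = j then R j x else 0))) =
      (\<Sum>i\<in>UNIV. \<Sum>j\<in>UNIV. y$j * (y$i * pderiv_at i (R j) x)) + (\<Sum>i\<in>UNIV. y$i * R i x)"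
    by (simp add: sum_distrib_left sum.distrib distrib_left mult_ac)
  also have "(\<Sum>i\<in>UNIV. \<Sum>j\<in>UNIV. y$j * (y$i * pderiv_at i (R j) x)) =
      (\<Sum>j\<in>UNIV. y$j * (\<Sum>i\<in>UNIV. y$i * pderiv_at i (R j) x))"
    by (subst sum.swap) (simp add: sum_distrib_left)
  finally show ?thesis
    unfolding pd by (simp add: y_def sum.distrib distrib_left)
qed

text \<open>Induction on \<open>n\<close> through the Hadamard quotients \<open>?g j\<close> of
  \<open>f\<close>: their solutions \<open>R j\<close> for \<open>n\<close>, multiplied by x_j -
  a_j, give the solution for \<open>Suc n\<close> up to a constant.\<close>

lemma taylor_modulo_euler:
  fixes f :: "real^'m::finite \<Rightarrow> real"
  assumes "smooth f"
  shows "\<exists>Q. smooth Q \<and> (\<forall>x. f x = (\<Sum>i\<in>UNIV. (x$i - a$i) * pderiv_at i Q x) - real n * Q x +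
    (\<Sum>is | length is = n. (\<Prod>i\<leftarrow>is. x$i - a$i) * foldr pderiv_at is f a) / fact n)"
  using assms
proof (induction n arbitrary: f)
  case 0
  let ?g = "\<lambda>i. ray_int a 0 (pderiv_at i f)"
  \<comment> \<open>The inner average is a Hadamard quotient of \<open>f\<close>; the outer one
    inverts the Euler operator plus 1, as the factor x_j - a_j requires. The Taylor part is then
    just \<open>f a\<close>. The \<open>+ 0\<close> fits the shape of
    \<open>euler_sum_nth_mult\<close>.\<close>
  let ?Q = "\<lambda>x. (\<Sum>j\<in>UNIV. (x$j - a$j) * ray_int a 0 (?g j) x) + 0"
  have smg: "smooth (?g i)" for i
    using 0 by (intro smooth_ray_int smooth_pderiv_at)
  have "f x = (\<Sum>i\<in>UNIV. (x$i - a$i) * pderiv_at i ?Q x) - real 0 * ?Q x +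
      (\<Sum>is | length is = 0. (\<Prod>i\<leftarrow>is. x$i - a$i) * foldr pderiv_at is f a) / fact 0" for x
    unfolding euler_sum_nth_mult[OF smooth_ray_int[OF smg]] euler_ray_int[OF smg]
    using hadamard_ray_int[OF 0, of x a] by simp
  moreover have "smooth ?Q"
    by (intro smooth_add smooth_sum smooth_mult smooth_ray_int smooth_pderiv_at 0 smooth_nth_diff smooth_const)
  ultimately show ?case
    by blast
next
  case (Suc n)
  let ?g = "\<lambda>i. ray_int a 0 (pderiv_at i f)"
  have smg: "smooth (?g i)" for i
    using Suc.prems by (intro smooth_ray_int smooth_pderiv_at)
  \<comment> \<open>The Taylor part of \<open>?g j\<close>, written with derivatives of
    \<open>f\<close>; \<open>fact (Suc n)\<close> already includes the 1/(n+1) from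
    \<open>ray_int_center\<close>.\<close>
  let ?T = "\<lambda>j x. (\<Sum>is | length is = n. (\<Prod>i\<leftarrow>is. x$i - a$i) * foldr pderiv_at (is @ [j]) f a) / fact (Suc n)"
  have T: "(\<Sum>is | length is = n. (\<Prod>i\<leftarrow>is. x$i - a$i) * foldr pderiv_at is (?g j) a) / fact n = ?T j x" for j x
    unfolding sum_divide_distrib
    by (rule sum.cong)
      (use Suc.prems in \<open>auto simp: foldr_pderiv_at_ray_int ray_int_center smooth_pderiv_at add.commute\<close>)
  have "\<forall>j. \<exists>Q. smooth Q \<and> (\<forall>x. ?g j x = (\<Sum>i\<in>UNIV. (x$i - a$i) * pderiv_at i Q x) - real n * Q x + ?T j x)"
    using Suc.IH[OF smg] unfolding T by blast
  from choice[OF this] obtain R where RR: "\<forall>j. smooth (R j) \<and> (\<forall>x. ?g j x =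
      (\<Sum>i\<in>UNIV. (x$i - a$i) * pderiv_at i (R j) x) - real n * R j x + ?T j x)" ..
  then have smR: "\<And>j. smooth (R j)"
    by blast
  from RR have R: "\<And>j x. ?g j x =
      (\<Sum>i\<in>UNIV. (x$i - a$i) * pderiv_at i (R j) x) - real n * R j x + ?T j x"
    by blast
  \<comment> \<open>The constant is chosen so that - (n+1) times it gives the term
    \<open>f a\<close> of Hadamard's formula.\<close>
  let ?Q = "\<lambda>x. (\<Sum>j\<in>UNIV. (x$j - a$j) * R j x) + - f a / real (Suc n)"
  have "f x = (\<Sum>i\<in>UNIV. (x$i - a$i) * pderiv_at i ?Q x) - real (Suc n) * ?Q x +
    (\<Sum>is | length is = Suc n. (\<Prod>i\<leftarrow>is. x$i - a$i) * foldr pderiv_at is f a) / fact (Suc n)" for x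
  proof -
    define y where "y = x - a"
    define E where "E j = (\<Sum>i\<in>UNIV. (x$i - a$i) * pderiv_at i (R j) x)" for j
    define t where "t j = ?T j x" for j
    have 1: "(\<Sum>is | length is = Suc n. (\<Prod>i\<leftarrow>is. x$i - a$i) * foldr pderiv_at is f a) / fact (Suc n) =
        (\<Sum>j\<in>UNIV. y$j * t j)"
      unfolding t_def
      unfolding sum_lists_Suc
      by (subst sum.swap, unfold sum_divide_distrib, rule sum.cong[OF refl])
        (simp add: y_def sum_distrib_left del: fact_Suc foldr_append, rule sum.cong, simp_all)
    have 2: "real (Suc n) * ?Q x = (\<Sum>j\<in>UNIV. y$j * (real (Suc n) * R j x)) - f a"
      by (simp add: y_def sum_distrib_left right_diff_distrib mult_ac del: of_nat_Suc)
    have "f x = f a + (\<Sum>j\<in>UNIV. y$j * ?g j x)"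
      using hadamard_ray_int[OF Suc.prems, of x a] by (simp add: y_def)
    also have "(\<Sum>j\<in>UNIV. y$j * ?g j x) =
        (\<Sum>j\<in>UNIV. y$j * (E j + R j x)) -
        (\<Sum>j\<in>UNIV. y$j * (real (Suc n) * R j x)) + (\<Sum>j\<in>UNIV. y$j * t j)"
    proof -
      have "y$j * ?g j x = y$j * (E j + R j x) - y$j * (real (Suc n) * R j x) + y$j * t j" for j
        unfolding R E_def[symmetric] t_def[symmetric] by (simp add: algebra_simps)
      then show ?thesis
        by (simp only: sum.distrib sum_subtractf)
    qed
    finally show ?thesis
      unfolding euler_sum_nth_mult[OF smR] 1 2 E_def[symmetric]
      by (simp only: y_def vector_minus_component)
  qed
  moreover have "smooth ?Q"
    by (intro smooth_add smooth_sum smooth_mult smR smooth_nth_diff smooth_const)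
  ultimately show ?case
    by (intro exI[of _ ?Q] conjI allI)
qed

section \<open>Monomials and their derivatives\<close>

text \<open>Serves for the monomials in the covector and, at x - a, for the Taylor
  monomials.\<close>

definition mpow :: "('m::finite \<Rightarrow> nat) \<Rightarrow> real^'m \<Rightarrow> real" where
  "mpow \<beta> \<xi> = (\<Prod>i\<in>UNIV. (\<xi>$i) ^ \<beta> i)"

text \<open>The \<open>a\<close>-th derivative of \<open>t ^ b\<close>; it vanishes for \<open>b < a\<close> since the product has the factor 0.\<close>

definition dpow :: "nat \<Rightarrow> nat \<Rightarrow> real \<Rightarrow> real" where
  "dpow a b t = (\<Prod>k<a. real b - real k) * t ^ (b - a)"

text \<open>The derivative of index \<alpha> of \<xi>^\<beta>. For \<alpha> of degree n it is also,
  up to the factor n!, the contraction \<open>T_op n\<close> of (x - a)^\<alpha> \<xi>^\<beta>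
  evaluated at a, hence the model for the values of \<open>A\<close>.\<close>

definition dmpow :: "('m::finite \<Rightarrow> nat) \<Rightarrow> ('m \<Rightarrow> nat) \<Rightarrow> real^'m \<Rightarrow> real" where
  "dmpow \<alpha> \<beta> \<xi> = (\<Prod>i\<in>UNIV. dpow (\<alpha> i) (\<beta> i) (\<xi>$i))"

text \<open>For \<open>\<beta> j = 0\<close> the subtraction truncates and the degree goes up; in the relations below \<open>move j i \<beta>\<close>
  then comes with the factor \<open>\<beta> j\<close>.\<close>

definition move :: "'m \<Rightarrow> 'm \<Rightarrow> ('m \<Rightarrow> nat) \<Rightarrow> 'm \<Rightarrow> nat" where
  "move j i \<beta> = (\<beta>(j := \<beta> j - 1))(i := Suc ((\<beta>(j := \<beta> j - 1)) i))"

definition single :: "'m \<Rightarrow> nat \<Rightarrow> 'm \<Rightarrow> nat" where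
  "single o' n = (\<lambda>_. 0)(o' := n)"

lemma dpow_0 [simp]: "dpow 0 b t = t ^ b"
  by (simp add: dpow_def)

lemma prod_falling_eq_0: "b < a \<Longrightarrow> (\<Prod>k<a. real b - real k) = 0"
  by (rule prod_zero) auto

lemma dpow_Suc: "dpow (Suc a) b t = real b * dpow a (b - 1) t"
proof (cases b)
  case 0
  then show ?thesis
    by (simp add: dpow_def prod.lessThan_Suc_shift del: prod.lessThan_Suc)
next
  case (Suc c)
  then show ?thesis
    unfolding dpow_def prod.lessThan_Suc_shift by simp
qed

lemma mult_dpow_Suc: "t * dpow (Suc a) b t = (real b - real a) * dpow a b t"
proof (cases "a < b")
  case True
  then have "t ^ (b - a) = t * t ^ (b - Suc a)"
    by (metis Suc_diff_Suc power_Suc)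
  then show ?thesis
    by (simp add: dpow_def)
qed (cases "a = b", auto simp: dpow_def prod_falling_eq_0)

text \<open>Leibniz rule for t * t^b, with two terms only because the second derivative of t
  vanishes. For a = 0 the factor \<open>real a\<close> removes the truncated
  \<open>a - 1\<close>.\<close>

lemma dpow_Suc_right: "dpow a (Suc b) t = t * dpow a b t + real a * dpow (a - 1) b t"
  by (cases a) (simp_all add: mult_dpow_Suc dpow_Suc[of _ "Suc b"] left_diff_distrib distrib_right)

lemma has_real_derivative_dpow: "(dpow a b has_real_derivative dpow (Suc a) b t) (at t)"
proof (cases "a \<le> b")
  case True
  have "(dpow a b has_real_derivative (\<Prod>k<a. real b - real k) * (real (b - a) * t ^ (b - a - 1))) (at t)"
    unfolding dpow_def by (auto intro!: derivative_eq_intros)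
  with True show ?thesis by (simp add: dpow_def mult_ac)
next
  case False
  then have "dpow a b = (\<lambda>t. 0)" "dpow (Suc a) b t = 0"
    by (auto simp: dpow_def prod_falling_eq_0)
  then show ?thesis by simp
qed

lemma has_derivative_prod_nth:
  assumes "\<And>i t. (g i has_real_derivative g' i t) (at t)"
  shows "((\<lambda>\<xi>::real^'m::finite. \<Prod>i\<in>UNIV. g i (\<xi>$i)) has_derivative
    (\<lambda>h. \<Sum>i\<in>UNIV. (g' i (\<xi>$i) * h$i) * (\<Prod>j\<in>UNIV - {i}. g j (\<xi>$j)))) (at \<xi>)"
proof (rule has_derivative_prod)
  fix i
  have "(g i has_derivative (*) (g' i (\<xi>$i))) (at (\<xi>$i))"
    using assms[of i "\<xi>$i"] by (simp add: has_field_derivative_def)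
  from has_derivative_compose[OF bounded_linear_imp_has_derivative[OF bounded_linear_vec_nth] this]
  show "((\<lambda>\<xi>. g i (\<xi>$i)) has_derivative (\<lambda>h. g' i (\<xi>$i) * h$i)) (at \<xi>)" .
qed

lemma pderiv_at_prod_nth:
  assumes "\<And>i t. (g i has_real_derivative g' i t) (at t)"
  shows "pderiv_at j (\<lambda>\<xi>::real^'m::finite. \<Prod>i\<in>UNIV. g i (\<xi>$i)) \<xi> =
    g' j (\<xi>$j) * (\<Prod>i\<in>UNIV - {j}. g i (\<xi>$i))"
proof -
  have "pderiv_at j (\<lambda>\<xi>::real^'m. \<Prod>i\<in>UNIV. g i (\<xi>$i)) \<xi> =
      (\<Sum>i\<in>UNIV. (g' i (\<xi>$i) * axis j 1 $ i) * (\<Prod>j\<in>UNIV - {i}. g j (\<xi>$j)))"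
    by (rule pderiv_at_eqI[OF has_derivative_prod_nth[OF assms]])
  also have "\<dots> = (\<Sum>i\<in>UNIV. if i = j then g' i (\<xi>$i) * (\<Prod>j\<in>UNIV - {i}. g j (\<xi>$j)) else 0)"
    by (rule sum.cong) (auto simp: axis_def)
  finally show ?thesis by simp
qed

lemma prod_UNIV_split: "(\<Prod>i\<in>UNIV. f i) = f j * (\<Prod>i\<in>UNIV - {j::'m::finite}. f i)"
  by (rule prod.remove) auto

lemma differentiable_dmpow [simp, intro]: "dmpow \<alpha> \<beta> differentiable (at \<xi>)"
  unfolding dmpow_def[abs_def] differentiable_def
  using has_derivative_prod_nth[OF has_real_derivative_dpow] by blast

lemma pderiv_at_dmpow: "pderiv_at j (dmpow \<alpha> \<beta>) \<xi> = dmpow (\<alpha>(j := Suc (\<alpha> j))) \<beta> \<xi>"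
proof -
  have "(\<Prod>i\<in>UNIV - {j}. dpow (\<alpha> i) (\<beta> i) (\<xi>$i)) = (\<Prod>i\<in>UNIV - {j}. dpow ((\<alpha>(j := Suc (\<alpha> j))) i) (\<beta> i) (\<xi>$i))"
    by (rule prod.cong) auto
  then show ?thesis
    unfolding dmpow_def[abs_def]
    by (subst pderiv_at_prod_nth[OF has_real_derivative_dpow]) (simp add: prod_UNIV_split[of _ j])
qed

lemma mpow_eq_dmpow: "mpow \<beta> = dmpow (\<lambda>_. 0) \<beta>"
  by (simp add: fun_eq_iff mpow_def dmpow_def)

lemma differentiable_mpow [simp, intro]: "mpow \<beta> differentiable (at \<xi>)"
  by (simp add: mpow_eq_dmpow)

lemma mpow_add_one: "mpow (\<beta>(i := Suc (\<beta> i))) \<xi> = \<xi>$i * mpow \<beta> \<xi>"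
proof -
  have "(\<Prod>k\<in>UNIV - {i}. (\<xi>$k) ^ (\<beta>(i := Suc (\<beta> i))) k) = (\<Prod>k\<in>UNIV - {i}. (\<xi>$k) ^ \<beta> k)"
    by (rule prod.cong) auto
  then show ?thesis
    unfolding mpow_def by (simp add: prod_UNIV_split[of _ i])
qed

lemma pderiv_at_mpow: "pderiv_at j (mpow \<beta>) \<xi> = real (\<beta> j) * mpow (\<beta>(j := \<beta> j - 1)) \<xi>"
proof -
  have "(\<Prod>i\<in>UNIV - {j}. (\<xi>$i) ^ \<beta> i) = (\<Prod>i\<in>UNIV - {j}. (\<xi>$i) ^ (\<beta>(j := \<beta> j - 1)) i)"
    by (rule prod.cong) auto
  moreover have "((\<lambda>t. t ^ \<beta> i) has_real_derivative real (\<beta> i) * t ^ (\<beta> i - 1)) (at t)" for i t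
    by (auto intro!: derivative_eq_intros)
  ultimately show ?thesis
    unfolding mpow_def[abs_def]
    by (subst pderiv_at_prod_nth[where g = "\<lambda>i t. t ^ \<beta> i" and g' = "\<lambda>i t. real (\<beta> i) * t ^ (\<beta> i - 1)"])
      (simp_all add: prod_UNIV_split[of _ j])
qed

lemma nth_mult_pderiv_at_mpow: "\<xi>$i * pderiv_at j (mpow \<beta>) \<xi> = real (\<beta> j) * mpow (move j i \<beta>) \<xi>"
  unfolding pderiv_at_mpow move_def mpow_add_one by simp

lemma sum_UNIV_split: "(\<Sum>i\<in>UNIV. f i) = f j + (\<Sum>i\<in>UNIV - {j::'m::finite}. f i)"
  by (rule sum.remove) auto

lemma sum_fun_upd: "sum (\<beta>(i := k)) UNIV = k + (\<Sum>i\<in>UNIV - {i::'m::finite}. \<beta> i)"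
  unfolding sum_UNIV_split[of _ i] by (auto intro!: sum.cong)

lemma sum_move: "\<beta> (j::'m::finite) > 0 \<Longrightarrow> sum (move j i \<beta>) UNIV = sum \<beta> UNIV"
proof -
  assume "\<beta> j > 0"
  have "sum (move j i \<beta>) UNIV = Suc (sum (\<beta>(j := \<beta> j - 1)) UNIV)"
    unfolding move_def sum_fun_upd[of _ i] by (simp add: sum_UNIV_split[of _ i])
  also have "\<dots> = sum \<beta> UNIV"
    using \<open>\<beta> j > 0\<close> unfolding sum_fun_upd sum_UNIV_split[of \<beta> j] by simp
  finally show ?thesis .
qed

lemma move_move: "i \<noteq> j \<Longrightarrow> \<beta> j > 0 \<Longrightarrow> move i j (move j i \<beta>) = \<beta>"
  by (auto simp: move_def fun_eq_iff)

lemma sum_single [simp]: "sum (single o' n) (UNIV :: 'm::finite set) = n"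
  unfolding single_def sum_fun_upd by simp

lemma single_simps [simp]: "single o' n o' = n" "i \<noteq> o' \<Longrightarrow> single o' n i = 0"
  by (auto simp: single_def)

lemma eq_single:
  assumes "sum \<beta> UNIV = n" "\<And>i. i \<noteq> o' \<Longrightarrow> \<beta> (i::'m::finite) = 0"
  shows "\<beta> = single o' n"
proof -
  have "sum \<beta> UNIV = \<beta> o'"
    using assms(2) by (simp add: sum_UNIV_split[of _ o'])
  with assms show ?thesis
    by (metis ext single_simps)
qed

text \<open>Leibniz rule for the derivative of index \<alpha> of \<xi>_i D_j \<xi>^\<beta>. It says
  that the contraction is one solution of the gl(m)-relations of the next lemma.\<close>

lemma dmpow_move:
  fixes \<alpha> \<beta> :: "'m::finite \<Rightarrow> nat"
  assumes "i \<noteq> j"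
  shows "real (\<alpha> i) * dmpow (move i j \<alpha>) \<beta> \<xi> =
    real (\<beta> j) * dmpow \<alpha> (move j i \<beta>) \<xi> - \<xi>$i * dmpow (\<alpha>(j := Suc (\<alpha> j))) \<beta> \<xi>"
proof -
  define R where "R = (\<Prod>k\<in>UNIV - {i} - {j}. dpow (\<alpha> k) (\<beta> k) (\<xi>$k))"
  have split: "(\<Prod>k\<in>UNIV. f k) = f i * (f j * (\<Prod>k\<in>UNIV - {i} - {j}. f k))" for f :: "'m \<Rightarrow> real"
    using assms by (subst prod_UNIV_split[of f i], subst prod.remove[of _ j]) auto
  have R: "R = (\<Prod>k\<in>UNIV - {i} - {j}. dpow (move i j \<alpha> k) (\<beta> k) (\<xi>$k))"
    "R = (\<Prod>k\<in>UNIV - {i} - {j}. dpow (\<alpha> k) (move j i \<beta> k) (\<xi>$k))"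
    "R = (\<Prod>k\<in>UNIV - {i} - {j}. dpow ((\<alpha>(j := Suc (\<alpha> j))) k) (\<beta> k) (\<xi>$k))"
    unfolding R_def by (auto intro!: prod.cong simp: move_def)
  show ?thesis
    unfolding dmpow_def split R[symmetric]
    using assms by (simp add: move_def dpow_Suc dpow_Suc_right algebra_simps)
qed

text \<open>The relation with \<open>\<alpha> = single o' n\<close> has vanishing left-hand side for \<open>i \<noteq> o'\<close> and, with \<open>j = o'\<close>, moves the exponents of \<open>\<xi>\<close>
  away from \<open>o'\<close>; with \<open>i = o'\<close> it then moves those of \<open>x\<close>.\<close>

lemma gl_relation_unique:
  fixes U :: "('m::finite \<Rightarrow> nat) \<Rightarrow> ('m \<Rightarrow> nat) \<Rightarrow> real^'m \<Rightarrow> real"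
  assumes rel: "\<And>\<alpha> \<beta> i j \<xi>. i \<noteq> j \<Longrightarrow> sum \<alpha> UNIV = n \<Longrightarrow> sum \<beta> UNIV = p \<Longrightarrow>
      real (\<alpha> i) * U (move i j \<alpha>) \<beta> \<xi> = real (\<beta> j) * U \<alpha> (move j i \<beta>) \<xi> - \<xi>$i * pderiv_at j (U \<alpha> \<beta>) \<xi>"
    and base: "U (single o' n) (single o' p) = (\<lambda>\<xi>. c * dmpow (single o' n) (single o' p) \<xi>)"
    and "sum \<alpha> UNIV = n" "sum \<beta> UNIV = p"
  shows "U \<alpha> \<beta> = (\<lambda>\<xi>. c * dmpow \<alpha> \<beta> \<xi>)"
proof -
  \<comment> \<open>Where \<open>U\<close> is already known to be \<open>c\<close> times the model,
    the relation of the model also evaluates \<xi>_i D_j of it, so the relation for \<open>U\<close>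
    can be solved for its one unknown term.\<close>
  have pd: "\<xi>$i * pderiv_at j (U \<alpha> \<beta>) \<xi> =
      c * (real (\<beta> j) * dmpow \<alpha> (move j i \<beta>) \<xi> - real (\<alpha> i) * dmpow (move i j \<alpha>) \<beta> \<xi>)"
    if "U \<alpha> \<beta> = (\<lambda>\<xi>. c * dmpow \<alpha> \<beta> \<xi>)" "i \<noteq> j" for \<alpha> \<beta> i j \<xi>
  proof -
    have "\<xi>$i * dmpow (\<alpha>(j := Suc (\<alpha> j))) \<beta> \<xi> =
        real (\<beta> j) * dmpow \<alpha> (move j i \<beta>) \<xi> - real (\<alpha> i) * dmpow (move i j \<alpha>) \<beta> \<xi>"
      using dmpow_move[OF that(2), of \<alpha> \<beta> \<xi>] by simp
    then show ?thesis
      unfolding that(1) by (simp add: pderiv_at_cmult pderiv_at_dmpow mult.left_commute)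
  qed
  have le: "\<gamma> o' \<le> sum \<gamma> UNIV" for \<gamma> :: "'m \<Rightarrow> nat"
    by (rule member_le_sum) auto
  have 1: "U (single o' n) \<beta> = (\<lambda>\<xi>. c * dmpow (single o' n) \<beta> \<xi>)" if "sum \<beta> UNIV = p" for \<beta>
    using that
  proof (induction "p - \<beta> o'" arbitrary: \<beta> rule: less_induct)
    case less
    show ?case
    proof (cases "\<exists>i. i \<noteq> o' \<and> \<beta> i > 0")
      case False
      then have "\<beta> = single o' p"
        using eq_single[OF less.prems] by auto
      with base show ?thesis by simp
    next
      case True
      then obtain i where i: "i \<noteq> o'" "\<beta> i > 0" by blast
      let ?b = "move i o' \<beta>"
      have s: "sum ?b UNIV = p" using i less.prems by (simp add: sum_move)
      have bo: "?b o' = Suc (\<beta> o')" using i by (simp add: move_def)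
      have "p - ?b o' < p - \<beta> o'" using bo le[of ?b] s by simp
      from less.hyps[OF this s]
      have IH: "U (single o' n) ?b = (\<lambda>\<xi>. c * dmpow (single o' n) ?b \<xi>)" .
      have "real (?b o') * U (single o' n) \<beta> \<xi> = c * (real (?b o') * dmpow (single o' n) \<beta> \<xi>)" for \<xi>
        using rel[of i o' "single o' n" ?b \<xi>] pd[OF IH i(1), of \<xi>] i s by (simp add: move_move)
      then show ?thesis
        using bo by (intro ext) (simp add: mult.left_commute)
    qed
  qed
  show ?thesis
    using assms(3,4)
  proof (induction "n - \<alpha> o'" arbitrary: \<alpha> \<beta> rule: less_induct)
    case less
    show ?case
    proof (cases "\<exists>j. j \<noteq> o' \<and> \<alpha> j > 0")
      case False
      then have "\<alpha> = single o' n"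
        using eq_single[OF less.prems(1)] by auto
      with 1[OF less.prems(2)] show ?thesis by simp
    next
      case True
      then obtain j where j: "j \<noteq> o'" "\<alpha> j > 0" by blast
      let ?a = "move j o' \<alpha>"
      have s: "sum ?a UNIV = n" using j less.prems by (simp add: sum_move)
      have ao: "?a o' = Suc (\<alpha> o')" using j by (simp add: move_def)
      have lt: "n - ?a o' < n - \<alpha> o'" using ao le[of ?a] s by simp
      note IH = less.hyps[OF lt s]
      \<comment> \<open>For \<beta> j = 0 the moved index has degree p + 1 and the induction
        hypothesis says nothing about it, but the factor vanishes.\<close>
      have 2: "real (\<beta> j) * U ?a (move j o' \<beta>) \<xi> = c * (real (\<beta> j) * dmpow ?a (move j o' \<beta>) \<xi>)" for \<xi>
      proof (cases "\<beta> j > 0")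
        case True
        then show ?thesis
          using IH[of "move j o' \<beta>"] less.prems by (simp add: sum_move)
      qed simp
      have "real (?a o') * U \<alpha> \<beta> \<xi> = c * (real (?a o') * dmpow \<alpha> \<beta> \<xi>)" for \<xi>
        using rel[of o' j ?a \<beta> \<xi>] pd[OF IH[OF less.prems(2)], of o' j \<xi>] 2[of \<xi>] j s less.prems
        by (simp add: move_move algebra_simps)
      then show ?thesis
        using ao by (intro ext) (simp add: mult.left_commute)
    qed
  qed
qed

section \<open>Homogeneous polynomials in the covector\<close>

definition hom_poly :: "nat \<Rightarrow> (real^'m::finite \<Rightarrow> real) \<Rightarrow> bool" where
  "hom_poly q f \<longleftrightarrow> (\<exists>k. f = (\<lambda>\<xi>. \<Sum>\<gamma> | sum \<gamma> UNIV = q. k \<gamma> * mpow \<gamma> \<xi>))"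

lemma differentiable_hom_poly: "hom_poly q f \<Longrightarrow> f differentiable (at \<xi>)"
  unfolding hom_poly_def
  by (auto intro!: differentiable_sum_fun finite_multi_indices)

lemma pderiv_at_hom_poly:
  "pderiv_at i (\<lambda>\<xi>. \<Sum>\<gamma> | sum \<gamma> UNIV = q. k \<gamma> * mpow \<gamma> \<xi>) \<xi> =
    (\<Sum>\<gamma> | sum \<gamma> UNIV = q. k \<gamma> * pderiv_at i (mpow \<gamma>) \<xi>)"
  by (subst pderiv_at_sum) (auto simp: pderiv_at_cmult)

lemma sum_nth_mult_pderiv_at_mpow:
  "(\<Sum>i\<in>UNIV. \<xi>$i * pderiv_at i (mpow \<gamma>) \<xi>) = real (sum \<gamma> UNIV) * mpow \<gamma> \<xi>"
proof -
  have "\<xi>$i * pderiv_at i (mpow \<gamma>) \<xi> = real (\<gamma> i) * mpow \<gamma> \<xi>" for i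
    unfolding nth_mult_pderiv_at_mpow by (cases "\<gamma> i") (auto simp: move_def fun_upd_idem)
  then show ?thesis
    by (simp add: sum_distrib_right)
qed

lemma euler_hom_poly:
  assumes "hom_poly q f"
  shows "(\<Sum>i\<in>UNIV. \<xi>$i * pderiv_at i f \<xi>) = real q * f \<xi>"
proof -
  from assms obtain k where k: "f = (\<lambda>\<xi>. \<Sum>\<gamma> | sum \<gamma> UNIV = q. k \<gamma> * mpow \<gamma> \<xi>)"
    unfolding hom_poly_def by blast
  have "(\<Sum>i\<in>UNIV. \<xi>$i * pderiv_at i f \<xi>) =
      (\<Sum>\<gamma> | sum \<gamma> UNIV = q. k \<gamma> * (\<Sum>i\<in>UNIV. \<xi>$i * pderiv_at i (mpow \<gamma>) \<xi>))"
    unfolding k pderiv_at_hom_poly sum_distrib_left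
    by (subst sum.swap) (simp add: mult_ac)
  also have "\<dots> = (\<Sum>\<gamma> | sum \<gamma> UNIV = q. real q * (k \<gamma> * mpow \<gamma> \<xi>))"
    unfolding sum_nth_mult_pderiv_at_mpow by (rule sum.cong) auto
  finally show ?thesis
    by (simp add: k sum_distrib_left)
qed

lemma hom_poly_scale:
  assumes "hom_poly q f"
  shows "f (s *\<^sub>R \<xi>) = s ^ q * f \<xi>"
proof -
  have "mpow \<gamma> (s *\<^sub>R \<xi>) = s ^ sum \<gamma> UNIV * mpow \<gamma> \<xi>" for \<gamma>
    by (simp add: mpow_def power_mult_distrib prod.distrib power_sum)
  with assms show ?thesis
    unfolding hom_poly_def by (auto simp: sum_distrib_left intro!: sum.cong)
qed

text \<open>Off the hyperplane \<xi>_i = 0 the i-th partial derivative vanishes, so \<open>f\<close>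
  does not depend on \<xi>_i. All coordinates but \<open>o'\<close> may then be set to 0 one after
  another, and homogeneity does the rest. This avoids comparing coefficients, and with it the linear
  independence of monomials.\<close>

lemma hom_poly_one_variable:
  fixes f :: "real^'m::finite \<Rightarrow> real"
  assumes f: "hom_poly q f" and zero: "\<And>i \<xi>. i \<noteq> o' \<Longrightarrow> \<xi>$i * pderiv_at i f \<xi> = 0"
  shows "f \<xi> = f (axis o' 1) * (\<xi>$o') ^ q"
proof -
  have kill: "f (\<chi> k. if k \<in> S then 0 else \<xi>$k) = f \<xi>" if "finite S" "o' \<notin> S" for S
    using that
  proof (induction S)
    case empty
    then show ?case by simp
  next
    case (insert i S)
    define \<eta> where "\<eta> = (\<chi> k. if k \<in> S then 0 else \<xi>$k)"
    define l where "l t = \<eta> + (t - \<eta>$i) *\<^sub>R axis i 1" for t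
    have l_nth: "l t $ i = t" for t
      by (simp add: l_def)
    have der: "((\<lambda>t. f (l t)) has_derivative (\<lambda>s. s * pderiv_at i f (l t))) (at t)" for t
    proof -
      have "(l has_derivative (\<lambda>s. s *\<^sub>R axis i 1)) (at t)"
        unfolding l_def by (auto intro!: derivative_eq_intros)
      from has_derivative_compose[OF this has_derivative_pderiv_at[OF differentiable_hom_poly[OF f]]]
      show ?thesis
        by (simp add: axis_def if_distrib[of "\<lambda>x. x * _"] if_distrib[of "\<lambda>x. _ * x"] cong: if_cong)
    qed
    \<comment> \<open>The derivative along the line is known to vanish only for t \<noteq> 0, where
      \<xi>_i can be cancelled; continuity bridges the exceptional point.\<close>
    have "f (l 0) = f (l (\<eta>$i))"
    proof (rule has_derivative_zero_unique_strong_convex[where S = UNIV and K = "{0}" and f = "\<lambda>t. f (l t)"])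
      show "continuous_on UNIV (\<lambda>t. f (l t))"
        using der has_derivative_continuous by (blast intro: continuous_at_imp_continuous_on)
      show "((\<lambda>t. f (l t)) has_derivative (\<lambda>h. 0)) (at t within UNIV)" if "t \<in> UNIV - {0}" for t
        using der[of t] zero[of i "l t"] that insert.prems by (auto simp: l_nth)
    qed auto
    moreover have "l (\<eta>$i) = \<eta>"
      by (simp add: l_def)
    moreover have "l 0 = (\<chi> k. if k \<in> insert i S then 0 else \<xi>$k)"
      by (auto simp: l_def vec_eq_iff axis_def \<eta>_def)
    ultimately show ?case
      using insert by (simp add: \<eta>_def)
  qed
  have "(\<chi> k. if k \<in> UNIV - {o'} then 0 else \<xi>$k) = \<xi>$o' *\<^sub>R axis o' 1"
    by (auto simp: vec_eq_iff axis_def)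
  with kill[of "UNIV - {o'}"] hom_poly_scale[OF f] show ?thesis
    by (metis (no_types) Diff_iff finite insertI1 mult.commute)
qed

section \<open>Tensor fields and Lie derivatives\<close>

lemma sym_tensor_fields_mpow:
  "P \<in> sym_tensor_fields k \<longleftrightarrow>
    (\<exists>c. (\<forall>\<beta>. smooth (c \<beta>)) \<and> P = (\<lambda>x \<xi>. \<Sum>\<beta> | sum \<beta> UNIV = k. c \<beta> x * mpow \<beta> \<xi>))"
  unfolding sym_tensor_fields_def mpow_def by (simp add: fun_eq_iff)

lemma sym_tensor_fieldsI:
  "(\<And>\<beta>. smooth (c \<beta>)) \<Longrightarrow> (\<lambda>x \<xi>. \<Sum>\<beta> | sum \<beta> UNIV = k. c \<beta> x * mpow \<beta> \<xi>) \<in> sym_tensor_fields k"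
  unfolding sym_tensor_fields_def mpow_def by blast

lemma sym_tensor_fields_add:
  assumes "P \<in> sym_tensor_fields k" "Q \<in> sym_tensor_fields k"
  shows "(\<lambda>x \<xi>. P x \<xi> + Q x \<xi>) \<in> sym_tensor_fields k"
proof -
  obtain c d where c: "\<forall>\<beta>. smooth (c \<beta>)" "P = (\<lambda>x \<xi>. \<Sum>\<beta> | sum \<beta> UNIV = k. c \<beta> x * mpow \<beta> \<xi>)"
    and d: "\<forall>\<beta>. smooth (d \<beta>)" "Q = (\<lambda>x \<xi>. \<Sum>\<beta> | sum \<beta> UNIV = k. d \<beta> x * mpow \<beta> \<xi>)"
    using assms unfolding sym_tensor_fields_mpow by blast
  show ?thesis
    using sym_tensor_fieldsI[of "\<lambda>\<beta> x. c \<beta> x + d \<beta> x" k] c d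
    by (simp add: distrib_right sum.distrib smooth_add)
qed

lemma sym_tensor_fields_cmult:
  assumes "P \<in> sym_tensor_fields k"
  shows "(\<lambda>x \<xi>. a * P x \<xi>) \<in> sym_tensor_fields k"
proof -
  obtain c where c: "\<forall>\<beta>. smooth (c \<beta>)" "P = (\<lambda>x \<xi>. \<Sum>\<beta> | sum \<beta> UNIV = k. c \<beta> x * mpow \<beta> \<xi>)"
    using assms unfolding sym_tensor_fields_mpow by blast
  show ?thesis
    using sym_tensor_fieldsI[of "\<lambda>\<beta> x. a * c \<beta> x" k] c
    by (simp add: sum_distrib_left mult.assoc smooth_mult)
qed

lemma zero_sym_tensor_field: "(\<lambda>x \<xi>. 0) \<in> sym_tensor_fields k"
  using sym_tensor_fieldsI[of "\<lambda>\<beta> x. 0" k] by simp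

lemma sym_tensor_fields_sum:
  "(\<And>l. l \<in> L \<Longrightarrow> f l \<in> sym_tensor_fields k) \<Longrightarrow>
    (\<lambda>x \<xi>. \<Sum>l\<in>L. f l x \<xi>) \<in> sym_tensor_fields k"
  by (induction L rule: infinite_finite_induct)
    (auto intro: zero_sym_tensor_field sym_tensor_fields_add)

lemma smooth_mult_mpow_sym_tensor_field:
  assumes "smooth c" "sum \<beta> UNIV = k"
  shows "(\<lambda>x \<xi>. c x * mpow \<beta> \<xi>) \<in> sym_tensor_fields k"
proof -
  have "(\<Sum>\<gamma> | sum \<gamma> UNIV = k. (if \<gamma> = \<beta> then c x else 0) * mpow \<gamma> \<xi>) = c x * mpow \<beta> \<xi>" for x \<xi>
    using assms(2) by (simp add: if_distrib[of "\<lambda>x. x * _"] finite_multi_indices cong: if_cong)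
  then show ?thesis
    using sym_tensor_fieldsI[of "\<lambda>\<gamma>. if \<gamma> = \<beta> then c else (\<lambda>x. 0)" k] assms(1)
    by (simp add: if_distribR)
qed

lemma hom_poly_sym_tensor_field: "P \<in> sym_tensor_fields k \<Longrightarrow> hom_poly k (P x)"
  unfolding sym_tensor_fields_mpow hom_poly_def by auto

lemma differentiable_sym_tensor_field:
  assumes "P \<in> sym_tensor_fields k"
  shows "(\<lambda>x. P x \<xi>) differentiable (at x)"
proof -
  obtain c where c: "\<forall>\<beta>. smooth (c \<beta>)" "P = (\<lambda>x \<xi>. \<Sum>\<beta> | sum \<beta> UNIV = k. c \<beta> x * mpow \<beta> \<xi>)"
    using assms unfolding sym_tensor_fields_mpow by blast
  show ?thesis
    unfolding c(2) by (intro smooth_differentiable smooth_sum smooth_mult c(1)[rule_format] smooth_const)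
qed

section \<open>Fields of the algebra and their Lie derivatives\<close>

lemma const_axis_sl_field: "(\<lambda>x. axis i 1) \<in> sl_fields"
  unfolding sl_fields_def by (rule vf.span_base) blast

lemma linear_sl_field: "(\<lambda>x. (x$j - b) *\<^sub>R axis i 1) \<in> sl_fields"
proof -
  have "(\<lambda>x. x$j *\<^sub>R axis i 1) \<in> sl_fields"
    unfolding sl_fields_def by (rule vf.span_base) force
  then have "(\<lambda>x. x$j *\<^sub>R axis i 1) - vf_scale b (\<lambda>x. axis i 1) \<in> sl_fields"
    using const_axis_sl_field unfolding sl_fields_def by (intro vf.span_diff vf.span_scale)
  moreover have "(\<lambda>x. x$j *\<^sub>R axis i 1) - vf_scale b (\<lambda>x. axis i 1) = (\<lambda>x. (x$j - b) *\<^sub>R axis i (1::real))"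
    by (auto simp: fun_eq_iff vf_scale_def algebra_simps)
  ultimately show ?thesis by simp
qed

lemma quadratic_sl_field: "(\<lambda>x. x$j *\<^sub>R x) \<in> sl_fields"
  unfolding sl_fields_def by (rule vf.span_base) blast

lemma lie_deriv_const_axis: "lie_deriv \<delta> (\<lambda>x. axis i 1) P = dx i P"
proof (intro ext)
  fix x \<xi>
  have "jacobian (\<lambda>x. axis i 1) x = 0"
    by (simp add: jacobian_def vec_eq_iff)
  then show "lie_deriv \<delta> (\<lambda>x. axis i 1) P x \<xi> = dx i P x \<xi>"
    by (simp add: lie_deriv_def rho_def trace_def axis_def if_distrib[of "\<lambda>x. x * _"] cong: if_cong)
qed

lemma lie_deriv_linear:
  "lie_deriv \<delta> (\<lambda>x. (x$j - b) *\<^sub>R axis i 1) P x \<xi> =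
    (x$j - b) * dx i P x \<xi> - \<xi>$i * pderiv_at j (P x) \<xi> + (if i = j then \<delta> else 0) * P x \<xi>"
proof -
  have pd: "pderiv_at l (\<lambda>y::real^'a. (y$j - b) * k) x = (if l = j then k else 0)" for l k
    by (subst pderiv_at_mult) auto
  have "jacobian (\<lambda>x. (x$j - b) *\<^sub>R axis i 1) x = (\<chi> k l. if k = i \<and> l = j then 1 else 0)"
    by (auto simp: jacobian_def vec_eq_iff pd axis_def)
  moreover have "rho (\<chi> k l. if k = i \<and> l = j then 1 else 0) (P x) \<xi> = \<xi>$i * pderiv_at j (P x) \<xi>"
  proof -
    have "(\<Sum>l\<in>UNIV. (if k = i \<and> l = j then 1 else 0) * \<xi>$k * pderiv_at l (P x) \<xi>) =
        (if k = i then \<xi>$i * pderiv_at j (P x) \<xi> else 0)" for k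
      by (simp add: if_distrib[of "\<lambda>x. x * _"] cong: if_cong)
    then show ?thesis by (simp add: rho_def)
  qed
  moreover have "trace (\<chi> k l. if k = i \<and> l = j then 1 else 0) = (if i = j then 1 else (0::real))"
  proof -
    have "trace (\<chi> k l. if k = i \<and> l = j then 1 else 0) = (\<Sum>k\<in>UNIV. if k = i then (if i = j then 1 else 0) else (0::real))"
      unfolding trace_def by (intro sum.cong) auto
    then show ?thesis by simp
  qed
  moreover have "(\<Sum>k\<in>UNIV. ((x$j - b) *\<^sub>R axis i 1) $ k * dx k P x \<xi>) = (x$j - b) * dx i P x \<xi>"
    by (simp add: axis_def if_distrib[of "\<lambda>x. x * _"] if_distrib[of "\<lambda>x. _ * x"] cong: if_cong)
  ultimately show ?thesis
    unfolding lie_deriv_def by simp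
qed

lemma jacobian_quadratic:
  "jacobian (\<lambda>x. x$j *\<^sub>R x) x = (\<chi> k l. (if l = k then x$j else 0) + (if l = j then x$k else 0))"
  unfolding jacobian_def by (auto simp: vec_eq_iff pderiv_at_mult)

text \<open>The Jacobian of x_j E is x_j times the identity plus the matrix whose column j is x. Its
  trace (m + 1) x_j is the origin of the denominator m + 1 in the value of \<delta>.\<close>

lemma lie_deriv_quadratic:
  fixes x :: "real^'m::finite"
  shows "lie_deriv \<delta> (\<lambda>x. x$j *\<^sub>R x) P x \<xi> =
    x$j * (\<Sum>k\<in>UNIV. x$k * dx k P x \<xi>) - x$j * (\<Sum>k\<in>UNIV. \<xi>$k * pderiv_at k (P x) \<xi>)
    - (\<Sum>k\<in>UNIV. x$k * (\<xi>$k * pderiv_at j (P x) \<xi>)) + \<delta> * (real CARD('m) + 1) * x$j * P x \<xi>"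
proof -
  have "rho (jacobian (\<lambda>x. x$j *\<^sub>R x) x) (P x) \<xi> = (\<Sum>k\<in>UNIV.
      x$j * (\<xi>$k * pderiv_at k (P x) \<xi>) + x$k * (\<xi>$k * pderiv_at j (P x) \<xi>))"
    unfolding rho_def
  proof (rule sum.cong[OF refl])
    fix k
    have "(\<Sum>l\<in>UNIV. jacobian (\<lambda>x. x$j *\<^sub>R x) x $ k $ l * \<xi>$k * pderiv_at l (P x) \<xi>) =
        (\<Sum>l\<in>UNIV. (if l = k then x$j * (\<xi>$k * pderiv_at l (P x) \<xi>) else 0) +
          (if l = j then x$k * (\<xi>$k * pderiv_at l (P x) \<xi>) else 0))"
      by (rule sum.cong) (auto simp: jacobian_quadratic algebra_simps)
    then show "(\<Sum>l\<in>UNIV. jacobian (\<lambda>x. x$j *\<^sub>R x) x $ k $ l * \<xi>$k * pderiv_at l (P x) \<xi>) =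
        x$j * (\<xi>$k * pderiv_at k (P x) \<xi>) + x$k * (\<xi>$k * pderiv_at j (P x) \<xi>)"
      by (simp add: sum.distrib)
  qed
  moreover have "trace (jacobian (\<lambda>x. x$j *\<^sub>R x) x) = (real CARD('m) + 1) * x$j"
    by (simp add: trace_def jacobian_quadratic sum.distrib distrib_right)
  ultimately show ?thesis
    unfolding lie_deriv_def by (simp add: sum.distrib sum_distrib_left mult_ac)
qed

lemma dx_smooth_mult: "smooth c \<Longrightarrow> dx i (\<lambda>x \<xi>. c x * h \<xi>) = (\<lambda>x \<xi>. pderiv_at i c x * h \<xi>)"
  by (auto simp: fun_eq_iff dx_def pderiv_at_mult smooth_differentiable)

lemma pderiv_at_translate:
  assumes "f differentiable (at (x - a))"
  shows "pderiv_at i (\<lambda>x. f (x - a)) x = pderiv_at i f (x - a)"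
proof -
  have "((\<lambda>x. x - a) has_derivative (\<lambda>h. h)) (at x)"
    by (auto intro!: derivative_eq_intros)
  from has_derivative_compose[OF this has_derivative_pderiv_at[OF assms]]
  show ?thesis
    by (subst pderiv_at_eqI, assumption) (simp add: axis_def if_distrib[of "\<lambda>x. x * _"] cong: if_cong)
qed

lemma smooth_mpow_translate: "smooth (\<lambda>x. mpow \<alpha> (x - a))"
  unfolding mpow_def vector_minus_component by (intro smooth_prod smooth_power smooth_nth_diff)

lemma pderiv_at_mpow_translate:
  "(x$j - a$j) * pderiv_at i (\<lambda>x. mpow \<alpha> (x - a)) x = real (\<alpha> i) * mpow (move i j \<alpha>) (x - a)"
  using nth_mult_pderiv_at_mpow[of "x - a" j i \<alpha>] by (simp add: pderiv_at_translate)

lemma prod_list_eq_mpow: "(\<Prod>i\<leftarrow>is. x$i - a$i) = mpow (count_list is) (x - a)"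
proof (induction "is")
  case Nil
  then show ?case by (simp add: mpow_def)
next
  case (Cons i "is")
  have "count_list (i # is) = (count_list is)(i := Suc (count_list is i))"
    by (auto simp: fun_eq_iff)
  with Cons show ?case by (simp only: mpow_add_one) simp
qed

lemma sum_count_list_UNIV: "sum (count_list is) (UNIV :: 'm::finite set) = length is"
proof (induction "is")
  case (Cons i "is")
  have "count_list (i # is) = (count_list is)(i := Suc (count_list is i))"
    by (auto simp: fun_eq_iff)
  with Cons show ?case by (simp only: sum_fun_upd) (simp add: sum_UNIV_split[of _ i])
qed simp

section \<open>The contraction in terms of coefficients\<close>

lemma foldr_dxi_mpow:
  assumes "finite L"
  shows "foldr dxi is (\<lambda>x \<xi>. \<Sum>\<beta>\<in>L. c \<beta> x * mpow \<beta> \<xi>) =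
    (\<lambda>x \<xi>. \<Sum>\<beta>\<in>L. c \<beta> x * dmpow (count_list is) \<beta> \<xi>)"
proof (induction "is")
  case Nil
  then show ?case by (simp add: mpow_eq_dmpow)
next
  case (Cons i "is")
  have count: "count_list (i # is) = (count_list is)(i := Suc (count_list is i))"
    by (auto simp: fun_eq_iff)
  then show ?case
    unfolding foldr.simps o_def Cons count
    by (intro ext) (simp add: fun_upd_def dxi_def pderiv_at_sum pderiv_at_cmult pderiv_at_dmpow)
qed

lemma foldr_dx_smooth_sum:
  assumes "finite L" "\<And>\<beta>. smooth (c \<beta>)"
  shows "foldr dx is (\<lambda>x \<xi>. \<Sum>\<beta>\<in>L. c \<beta> x * h \<beta> \<xi>) =
    (\<lambda>x \<xi>. \<Sum>\<beta>\<in>L. foldr pderiv_at is (c \<beta>) x * h \<beta> \<xi>)"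
proof (induction "is")
  case (Cons i "is")
  have "smooth (foldr pderiv_at is (c \<beta>))" for \<beta>
    by (intro smooth_foldr_pderiv_at assms)
  then show ?case
    unfolding foldr.simps o_def Cons
    by (auto simp: fun_eq_iff dx_def pderiv_at_sum pderiv_at_mult smooth_differentiable)
qed simp

lemma T_op_eq:
  assumes "\<And>\<beta>. smooth (c \<beta>)"
  shows "T_op n (\<lambda>x \<xi>. \<Sum>\<beta> | sum \<beta> UNIV = k. c \<beta> x * mpow \<beta> \<xi>) x \<xi> =
    (\<Sum>\<beta> | sum \<beta> UNIV = k. \<Sum>is | length is = n. foldr pderiv_at is (c \<beta>) x * dmpow (count_list is) \<beta> \<xi>)"
  unfolding T_op_def foldr_dxi_mpow[OF finite_multi_indices] foldr_dx_smooth_sum[OF finite_multi_indices assms]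
  by (rule sum.swap)

lemma T_op_0 [simp]: "T_op 0 P = P"
  by (simp add: T_op_def)

text \<open>Off \<open>o'\<close> each factor is the full derivative of 1 or of t, that is 0! or 1!.
  The second case occurs in \<open>delta_eq\<close>, where one exponent is moved away from
  \<open>o'\<close>.\<close>

lemma dmpow_axis:
  assumes "\<And>i. i \<noteq> o' \<Longrightarrow> \<alpha> i = (\<beta> i :: nat) \<and> \<beta> i \<le> 1"
  shows "dmpow \<alpha> \<beta> \<xi> = dpow (\<alpha> o') (\<beta> o') (\<xi>$o')"
proof -
  have "dpow (\<alpha> i) (\<beta> i) (\<xi>$i) = 1" if "i \<noteq> o'" for i
    using assms[OF that] by (cases "\<beta> i") (auto simp: dpow_def)
  then show ?thesis
    by (simp add: dmpow_def prod_UNIV_split[of _ o'])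
qed

section \<open>Equivariant maps\<close>

locale sl_equivariant =
  fixes A :: "'m::finite tensor_field \<Rightarrow> 'm tensor_field" and \<delta> :: real and p q :: nat
  assumes q_le_p: "q \<le> p"
    and linear: "linear_between (sym_tensor_fields p) (sym_tensor_fields q) A"
    and equivariant: "X \<in> sl_fields \<Longrightarrow> P \<in> sym_tensor_fields p \<Longrightarrow>
      lie_deriv \<delta> X (A P) = A (lie_deriv \<delta> X P)"
begin

abbreviation n where "n \<equiv> p - q"

definition coeff_map :: "(real^'m \<Rightarrow> real) \<Rightarrow> ('m \<Rightarrow> nat) \<Rightarrow> 'm tensor_field" where
  "coeff_map c \<beta> = A (\<lambda>x \<xi>. c x * mpow \<beta> \<xi>)"

text \<open>Centre and point of evaluation coincide; the values with \<alpha> of degree n are the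
  only data about \<open>A\<close> that \<open>coeff_map_taylor\<close> retains.\<close>

definition taylor_map :: "real^'m \<Rightarrow> ('m \<Rightarrow> nat) \<Rightarrow> ('m \<Rightarrow> nat) \<Rightarrow> real^'m \<Rightarrow> real" where
  "taylor_map a \<alpha> \<beta> = coeff_map (\<lambda>x. mpow \<alpha> (x - a)) \<beta> a"

lemma A_range: "P \<in> sym_tensor_fields p \<Longrightarrow> A P \<in> sym_tensor_fields q"
  using linear unfolding linear_between_def by blast

lemma A_add: "P \<in> sym_tensor_fields p \<Longrightarrow> Q \<in> sym_tensor_fields p \<Longrightarrow>
    A (\<lambda>x \<xi>. P x \<xi> + Q x \<xi>) = (\<lambda>x \<xi>. A P x \<xi> + A Q x \<xi>)"
  using linear unfolding linear_between_def by blast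

lemma A_cmult: "P \<in> sym_tensor_fields p \<Longrightarrow> A (\<lambda>x \<xi>. c * P x \<xi>) = (\<lambda>x \<xi>. c * A P x \<xi>)"
  using linear unfolding linear_between_def by blast

lemma A_zero: "A (\<lambda>x \<xi>. 0) = (\<lambda>x \<xi>. 0)"
  using A_cmult[OF zero_sym_tensor_field, of 0] by simp

lemma A_sum: "finite L \<Longrightarrow> (\<And>l. l \<in> L \<Longrightarrow> f l \<in> sym_tensor_fields p) \<Longrightarrow>
    A (\<lambda>x \<xi>. \<Sum>l\<in>L. f l x \<xi>) = (\<lambda>x \<xi>. \<Sum>l\<in>L. A (f l) x \<xi>)"
  by (induction L rule: finite_induct) (auto simp: A_zero A_add sym_tensor_fields_sum)

lemma coeff_map_add:
  assumes "smooth c" "smooth d" "sum \<beta> UNIV = p"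
  shows "coeff_map (\<lambda>x. c x + d x) \<beta> a \<xi> = coeff_map c \<beta> a \<xi> + coeff_map d \<beta> a \<xi>"
  using assms A_add[of "\<lambda>x \<xi>. c x * mpow \<beta> \<xi>" "\<lambda>x \<xi>. d x * mpow \<beta> \<xi>"]
  by (simp add: coeff_map_def distrib_right smooth_mult_mpow_sym_tensor_field)

lemma coeff_map_cmult:
  assumes "smooth c" "sum \<beta> UNIV = p"
  shows "coeff_map (\<lambda>x. k * c x) \<beta> a \<xi> = k * coeff_map c \<beta> a \<xi>"
  using assms A_cmult[of "\<lambda>x \<xi>. c x * mpow \<beta> \<xi>" k]
  by (simp add: coeff_map_def mult.assoc smooth_mult_mpow_sym_tensor_field)

lemma coeff_map_sum:
  assumes "finite L" "\<And>l. smooth (c l)" "sum \<beta> UNIV = p"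
  shows "coeff_map (\<lambda>x. \<Sum>l\<in>L. k l * c l x) \<beta> a \<xi> = (\<Sum>l\<in>L. k l * coeff_map (c l) \<beta> a \<xi>)"
  using assms(1)
proof (induction L rule: finite_induct)
  case empty
  then show ?case by (simp add: coeff_map_def A_zero)
next
  case (insert l L)
  have "smooth (\<lambda>x. k l * c l x)" "smooth (\<lambda>x. \<Sum>l\<in>L. k l * c l x)"
    using assms by (auto intro!: smooth_mult smooth_sum)
  with insert assms show ?case by (simp add: coeff_map_add coeff_map_cmult)
qed

lemma hom_poly_coeff_map: "smooth c \<Longrightarrow> sum \<beta> UNIV = p \<Longrightarrow> hom_poly q (coeff_map c \<beta> a)"
  unfolding coeff_map_def
  by (intro hom_poly_sym_tensor_field A_range smooth_mult_mpow_sym_tensor_field)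

text \<open>The Lie derivative along a constant field is a partial derivative, so \<open>A\<close>
  commutes with partial derivatives in x.\<close>

lemma pderiv_at_coeff_map:
  assumes "smooth c" "sum \<beta> UNIV = p"
  shows "pderiv_at i (\<lambda>x. coeff_map c \<beta> x \<xi>) a = coeff_map (pderiv_at i c) \<beta> a \<xi>"
  using equivariant[OF const_axis_sl_field smooth_mult_mpow_sym_tensor_field[OF assms], of i]
  by (simp add: lie_deriv_const_axis dx_smooth_mult assms coeff_map_def) (simp add: dx_def fun_eq_iff)

text \<open>The divergence terms on the two sides cancel, so \<open>\<delta>\<close> does not occur.\<close>

lemma coeff_map_linear_field:
  assumes c: "smooth c" and \<beta>: "sum \<beta> UNIV = p"
  shows "coeff_map (\<lambda>x. (x$j - a$j) * pderiv_at i c x) \<beta> a \<xi> =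
    real (\<beta> j) * coeff_map c (move j i \<beta>) a \<xi> - \<xi>$i * pderiv_at j (coeff_map c \<beta> a) \<xi>"
proof -
  let ?P = "\<lambda>x \<xi>. c x * mpow \<beta> \<xi>"
  let ?X = "\<lambda>x::real^'m. (x$j - a$j) *\<^sub>R axis i (1::real)"
  let ?e = "if i = j then \<delta> else 0"
  let ?P1 = "\<lambda>x \<xi>. ((x$j - a$j) * pderiv_at i c x) * mpow \<beta> \<xi>"
  let ?P2 = "\<lambda>x \<xi>. c x * mpow (move j i \<beta>) \<xi>"
  let ?P3 = "\<lambda>x \<xi>. (?e * c x) * mpow \<beta> \<xi>"
  have P: "?P \<in> sym_tensor_fields p"
    using c \<beta> by (rule smooth_mult_mpow_sym_tensor_field)
  have P1: "?P1 \<in> sym_tensor_fields p"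
    by (intro smooth_mult_mpow_sym_tensor_field smooth_mult smooth_nth_diff smooth_pderiv_at c \<beta>)
  have P3: "?P3 \<in> sym_tensor_fields p"
    by (intro smooth_mult_mpow_sym_tensor_field smooth_mult smooth_const c \<beta>)
  \<comment> \<open>For \<beta> j = 0 the monomial in \<open>?P2\<close> has degree p + 1, outside
    the space on which \<open>A\<close> is linear. Only its product with the factor, then the zero
    field, is handled.\<close>
  have P2: "(\<lambda>x \<xi>. - real (\<beta> j) * ?P2 x \<xi>) \<in> sym_tensor_fields p \<and>
      A (\<lambda>x \<xi>. - real (\<beta> j) * ?P2 x \<xi>) = (\<lambda>x \<xi>. - real (\<beta> j) * A ?P2 x \<xi>)"
  proof (cases "\<beta> j > 0")
    case True
    then have "?P2 \<in> sym_tensor_fields p"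
      using c \<beta> by (intro smooth_mult_mpow_sym_tensor_field) (auto simp: sum_move)
    then show ?thesis
      by (intro conjI sym_tensor_fields_cmult A_cmult)
  qed (simp add: A_zero zero_sym_tensor_field)
  have lie: "lie_deriv \<delta> ?X ?P = (\<lambda>x \<xi>. ?P1 x \<xi> + (- real (\<beta> j) * ?P2 x \<xi> + ?P3 x \<xi>))"
  proof (intro ext)
    fix x \<xi>
    have "\<xi>$i * pderiv_at j (\<lambda>\<xi>. c x * mpow \<beta> \<xi>) \<xi> = c x * (\<xi>$i * pderiv_at j (mpow \<beta>) \<xi>)"
      by (simp add: pderiv_at_cmult)
    also have "\<dots> = real (\<beta> j) * ?P2 x \<xi>"
      unfolding nth_mult_pderiv_at_mpow by simp
    finally show "lie_deriv \<delta> ?X ?P x \<xi> = ?P1 x \<xi> + (- real (\<beta> j) * ?P2 x \<xi> + ?P3 x \<xi>)"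
      unfolding lie_deriv_linear by (simp add: dx_smooth_mult c)
  qed
  have "A (lie_deriv \<delta> ?X ?P) a \<xi> = A ?P1 a \<xi> + (- real (\<beta> j) * A ?P2 a \<xi> + A ?P3 a \<xi>)"
    unfolding lie
    by (simp only: A_add[OF P1 sym_tensor_fields_add[OF conjunct1[OF P2] P3]]
        A_add[OF conjunct1[OF P2] P3] conjunct2[OF P2])
  moreover have "A ?P3 a \<xi> = ?e * A ?P a \<xi>"
    using coeff_map_cmult[OF c \<beta>, of ?e a \<xi>] by (simp add: coeff_map_def)
  \<comment> \<open>The field vanishes at \<open>a\<close>, so the transport term with the unknown
    x-derivative of \<open>A ?P\<close> drops out.\<close>
  moreover have "lie_deriv \<delta> ?X (A ?P) a \<xi> = - (\<xi>$i * pderiv_at j (A ?P a) \<xi>) + ?e * A ?P a \<xi>"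
    unfolding lie_deriv_linear by simp
  ultimately show ?thesis
    using equivariant[OF linear_sl_field P, of j "a$j" i] by (simp add: coeff_map_def)
qed

text \<open>Sum of the diagonal relations i = j: the exponents of \<beta> add up to p, and Euler's
  identity for the value of \<open>A\<close>, of degree q in \<xi>, gives q. The eigenvalue is the
  difference n.\<close>

lemma coeff_map_euler:
  assumes c: "smooth c" and \<beta>: "sum \<beta> UNIV = p"
  shows "coeff_map (\<lambda>x. (\<Sum>i\<in>UNIV. (x$i - a$i) * pderiv_at i c x) - real n * c x) \<beta> a \<xi> = 0"
proof -
  have sm: "smooth (\<lambda>x. (x$i - a$i) * pderiv_at i c x)" for i
    by (intro smooth_mult smooth_nth_diff smooth_pderiv_at c)
  have "coeff_map (\<lambda>x. \<Sum>i\<in>UNIV. 1 * ((x$i - a$i) * pderiv_at i c x)) \<beta> a \<xi> =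
      (\<Sum>i\<in>UNIV. 1 * coeff_map (\<lambda>x. (x$i - a$i) * pderiv_at i c x) \<beta> a \<xi>)"
    by (intro coeff_map_sum sm \<beta>) auto
  also have "\<dots> = (\<Sum>i\<in>UNIV. real (\<beta> i) * coeff_map c \<beta> a \<xi> - \<xi>$i * pderiv_at i (coeff_map c \<beta> a) \<xi>)"
  proof (rule sum.cong[OF refl])
    fix i
    show "1 * coeff_map (\<lambda>x. (x$i - a$i) * pderiv_at i c x) \<beta> a \<xi> =
        real (\<beta> i) * coeff_map c \<beta> a \<xi> - \<xi>$i * pderiv_at i (coeff_map c \<beta> a) \<xi>"
      unfolding coeff_map_linear_field[OF c \<beta>]
      by (cases "\<beta> i") (auto simp: move_def fun_upd_idem)
  qed
  also have "\<dots> = real p * coeff_map c \<beta> a \<xi> - real q * coeff_map c \<beta> a \<xi>"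
    unfolding sum_subtractf euler_hom_poly[OF hom_poly_coeff_map[OF c \<beta>]]
    using \<beta> by (simp add: sum_distrib_right[symmetric] flip: of_nat_sum)
  also have "\<dots> = real n * coeff_map c \<beta> a \<xi>"
    using q_le_p by (simp add: of_nat_diff left_diff_distrib)
  finally have "coeff_map (\<lambda>x. \<Sum>i\<in>UNIV. (x$i - a$i) * pderiv_at i c x) \<beta> a \<xi> = real n * coeff_map c \<beta> a \<xi>"
    by simp
  moreover have "coeff_map (\<lambda>x. (\<Sum>i\<in>UNIV. (x$i - a$i) * pderiv_at i c x) + - real n * c x) \<beta> a \<xi> =
      coeff_map (\<lambda>x. \<Sum>i\<in>UNIV. (x$i - a$i) * pderiv_at i c x) \<beta> a \<xi> + - real n * coeff_map c \<beta> a \<xi>"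
  proof (subst coeff_map_add)
    show "smooth (\<lambda>x. \<Sum>i\<in>UNIV. (x$i - a$i) * pderiv_at i c x)"
      by (rule smooth_sum) (rule sm)
    show "smooth (\<lambda>x. - real n * c x)"
      by (intro smooth_mult smooth_const c)
  qed (simp_all only: \<beta> coeff_map_cmult[OF c \<beta>])
  ultimately show ?thesis
    by simp
qed

text \<open>All Taylor terms of degree other than n and the remainder are absorbed exactly into the
  Euler image of one smooth \<open>Q\<close>, which \<open>coeff_map_euler\<close>
  annihilates.\<close>

lemma coeff_map_taylor:
  assumes c: "smooth c" and \<beta>: "sum \<beta> UNIV = p"
  shows "coeff_map c \<beta> a \<xi> =
    (\<Sum>is | length is = n. foldr pderiv_at is c a * taylor_map a (count_list is) \<beta> \<xi>) / fact n"
proof -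
  obtain Q where Q: "smooth Q" "\<forall>x. c x = (\<Sum>i\<in>UNIV. (x$i - a$i) * pderiv_at i Q x) - real n * Q x +
      (\<Sum>is | length is = n. (\<Prod>i\<leftarrow>is. x$i - a$i) * foldr pderiv_at is c a) / fact n"
    using taylor_modulo_euler[OF c, of a n] by blast
  let ?E = "\<lambda>x. (\<Sum>i\<in>UNIV. (x$i - a$i) * pderiv_at i Q x) - real n * Q x"
  let ?T = "\<lambda>x. \<Sum>is | length is = n. (foldr pderiv_at is c a / fact n) * mpow (count_list is) (x - a)"
  have fin: "finite {is :: 'm list. length is = n}"
    using finite_lists_length_eq[of "UNIV :: 'm set" n] by simp
  have "c x = ?E x + ?T x" for x
    using Q(2)[rule_format, of x] by (simp only: prod_list_eq_mpow sum_divide_distrib) (simp add: mult.commute)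
  then have "c = (\<lambda>x. ?E x + ?T x)" by blast
  then have "coeff_map c \<beta> a \<xi> = coeff_map (\<lambda>x. ?E x + ?T x) \<beta> a \<xi>"
    by (rule arg_cong)
  also have "\<dots> = coeff_map ?E \<beta> a \<xi> + coeff_map ?T \<beta> a \<xi>"
  proof (rule coeff_map_add[OF _ _ \<beta>])
    have "smooth (\<lambda>x. (\<Sum>i\<in>UNIV. (x$i - a$i) * pderiv_at i Q x) + - real n * Q x)"
      by (intro smooth_add smooth_sum smooth_mult smooth_nth_diff smooth_pderiv_at Q(1) smooth_const)
    then show "smooth ?E" by simp
    show "smooth ?T"
      by (intro smooth_sum smooth_mult smooth_mpow_translate smooth_const)
  qed
  also have "coeff_map ?E \<beta> a \<xi> = 0"
    by (rule coeff_map_euler[OF Q(1) \<beta>])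
  also have "coeff_map ?T \<beta> a \<xi> = (\<Sum>is | length is = n. (foldr pderiv_at is c a / fact n) * taylor_map a (count_list is) \<beta> \<xi>)"
    unfolding taylor_map_def by (intro coeff_map_sum fin smooth_mpow_translate \<beta>)
  finally show ?thesis
    by (simp add: sum_divide_distrib)
qed

text \<open>The field (x_j - a_j) \<partial>_i keeps Taylor monomials at \<open>a\<close> among
  their multiples. The directions cross: an exponent of x goes from i to j, one of \<xi> from j to
  i.\<close>

lemma taylor_map_relation:
  assumes "sum \<beta> UNIV = p"
  shows "real (\<alpha> i) * taylor_map a (move i j \<alpha>) \<beta> \<xi> =
    real (\<beta> j) * taylor_map a \<alpha> (move j i \<beta>) \<xi> - \<xi>$i * pderiv_at j (taylor_map a \<alpha> \<beta>) \<xi>"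
  using coeff_map_linear_field[OF smooth_mpow_translate assms, of j a i \<alpha> a \<xi>]
    coeff_map_cmult[OF smooth_mpow_translate assms, of "real (\<alpha> i)" "move i j \<alpha>" a a \<xi>]
  by (simp add: taylor_map_def pderiv_at_mpow_translate)

text \<open>A Taylor monomial is an eigenfunction of the Euler operator about \<open>a\<close>, with
  its degree as eigenvalue.\<close>

lemma taylor_map_eq_0:
  assumes "sum \<beta> UNIV = p" "sum \<alpha> UNIV \<noteq> n"
  shows "taylor_map a \<alpha> \<beta> \<xi> = 0"
proof -
  have "(\<Sum>i\<in>UNIV. (x$i - a$i) * pderiv_at i (\<lambda>x. mpow \<alpha> (x - a)) x) - real n * mpow \<alpha> (x - a) =
      (real (sum \<alpha> UNIV) - real n) * mpow \<alpha> (x - a)" for x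
    using sum_nth_mult_pderiv_at_mpow[of "x - a" \<alpha>]
    by (simp add: pderiv_at_translate left_diff_distrib)
  then have "(real (sum \<alpha> UNIV) - real n) * taylor_map a \<alpha> \<beta> \<xi> = 0"
    using coeff_map_euler[OF smooth_mpow_translate assms(1), of a \<alpha> a \<xi>]
      coeff_map_cmult[OF smooth_mpow_translate assms(1), of "real (sum \<alpha> UNIV) - real n" \<alpha> a a \<xi>]
    by (simp only: taylor_map_def)
  moreover have "real (sum \<alpha> UNIV) - real n \<noteq> 0"
    using assms(2) by (simp only: right_minus_eq of_nat_eq_iff not_False_eq_True)
  ultimately show ?thesis
    by (simp only: mult_eq_0_iff simp_thms)
qed

text \<open>Here p - n = q, and the constant is the falling product p (p-1) ... (q+1).\<close>

lemma dpow_top: "dpow n p t = dpow n p 1 * t ^ q" "dpow n p 1 \<noteq> 0"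
  using q_le_p by (auto simp: dpow_def)

lemma dmpow_single: "dmpow (single o' n) (single o' p) \<xi> = dpow n p 1 * (\<xi>$o') ^ q"
  by (simp add: dmpow_axis[of o'] dpow_top(1)[of "_ $ _"])

lemma taylor_map_dmpow:
  "\<exists>c. \<forall>\<alpha> \<beta>. sum \<alpha> UNIV = n \<longrightarrow> sum \<beta> UNIV = p \<longrightarrow> taylor_map a \<alpha> \<beta> = (\<lambda>\<xi>. c * dmpow \<alpha> \<beta> \<xi>)"
proof -
  obtain o' :: 'm where True by simp
  let ?u = "taylor_map a (single o' n) (single o' p)"
  have hom: "hom_poly q ?u"
    unfolding taylor_map_def by (intro hom_poly_coeff_map smooth_mpow_translate sum_single)
  define v where "v = ?u (axis o' 1)"
  have u: "?u \<xi> = v * (\<xi>$o') ^ q" for \<xi>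
    unfolding v_def
  proof (rule hom_poly_one_variable[OF hom])
    fix i \<xi>
    assume "i \<noteq> o'"
    \<comment> \<open>Diagonal relation for i: neither exponent involves i, so both terms with a
      coefficient vanish and the weight of \<xi>_i is 0.\<close>
    then show "\<xi>$i * pderiv_at i ?u \<xi> = 0"
      using taylor_map_relation[of "single o' p" "single o' n" i a i \<xi>] by simp
  qed
  \<comment> \<open>Dividing by \<open>dpow n p 1\<close> normalises the scalar so that the model
    agrees on this one pair of indices, as \<open>gl_relation_unique\<close> requires.\<close>
  have "?u = (\<lambda>\<xi>. v / dpow n p 1 * dmpow (single o' n) (single o' p) \<xi>)"
    using dpow_top(2) by (intro ext) (simp add: u dmpow_single)
  then show ?thesis
    using gl_relation_unique[where U = "taylor_map a" and n = n and p = p and o' = o'] taylor_map_relation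
    by blast
qed

text \<open>Binomial expansion around \<open>a\<close>, of which only the part of degree n can
  survive. Powers centred at the origin are wanted because the dependence on \<open>a\<close> is
  studied by differentiating \<open>A\<close> of a fixed field.\<close>

lemma coeff_map_power:
  assumes "k \<le> n"
  shows "coeff_map (\<lambda>x. (x$o') ^ k) (single o' p) a \<xi> =
    (if k = n then taylor_map a (single o' n) (single o' p) \<xi> else 0)"
proof -
  have mp: "mpow (single o' l) x = (x$o') ^ l" for l and x :: "real^'m"
    by (simp add: mpow_def prod_UNIV_split[of _ o'])
  have "(x$o') ^ k = (\<Sum>l\<le>k. (of_nat (k choose l) * (a$o') ^ (k - l)) * mpow (single o' l) (x - a))" for x
    using binomial_ring[of "x$o' - a$o'" "a$o'" k] by (simp add: mp mult_ac)
  then have "coeff_map (\<lambda>x. (x$o') ^ k) (single o' p) a \<xi> =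
      (\<Sum>l\<le>k. (of_nat (k choose l) * (a$o') ^ (k - l)) * taylor_map a (single o' l) (single o' p) \<xi>)"
    unfolding taylor_map_def
    by (simp only:) (intro coeff_map_sum smooth_mpow_translate sum_single finite_atMost)
  also have "\<dots> = (\<Sum>l\<le>k. if l = n then taylor_map a (single o' n) (single o' p) \<xi> else 0)"
    using assms by (intro sum.cong) (auto simp: taylor_map_eq_0)
  finally show ?thesis
    using assms by auto
qed

text \<open>Up to a nonzero factor the scalar at \<open>a\<close> is the value at \<open>a\<close>
  of \<open>A\<close> on the single field x_o^n \<xi>_o^p. Its partial derivatives are multiples of
  \<open>A\<close> on x_o^(n-1) \<xi>_o^p, which vanishes because n - 1 is not the critical
  degree.\<close>

lemma taylor_map_const:
  obtains c where "\<And>a \<alpha> \<beta>. sum \<alpha> UNIV = n \<Longrightarrow> sum \<beta> UNIV = p \<Longrightarrow>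
    taylor_map a \<alpha> \<beta> = (\<lambda>\<xi>. c * dmpow \<alpha> \<beta> \<xi>)"
proof -
  obtain c where c: "\<And>a \<alpha> \<beta>. sum \<alpha> UNIV = n \<Longrightarrow> sum \<beta> UNIV = p \<Longrightarrow>
      taylor_map a \<alpha> \<beta> = (\<lambda>\<xi>. c a * dmpow \<alpha> \<beta> \<xi>)"
    using taylor_map_dmpow by metis
  obtain o' :: 'm where True by simp
  let ?f = "\<lambda>a. coeff_map (\<lambda>x. (x$o') ^ n) (single o' p) a (axis o' 1)"
  have f: "?f a = c a * dpow n p 1" for a
    by (simp add: coeff_map_power c dmpow_single)
  have sm: "smooth (\<lambda>x::real^'m. (x$o') ^ k)" for k
    by (intro smooth_power smooth_nth)
  have pd: "pderiv_at i ?f a = 0" for i a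
  proof -
    have "pderiv_at i (\<lambda>x. (x$o') ^ n) = (\<lambda>x::real^'m. (if i = o' then real n else 0) * (x$o') ^ (n - 1))"
    proof
      fix x :: "real^'m"
      have "((\<lambda>x::real^'m. (x$o') ^ n) has_derivative (\<lambda>h. real n * h$o' * (x$o') ^ (n - 1))) (at x)"
        by (rule has_derivative_power) (rule bounded_linear_imp_has_derivative[OF bounded_linear_vec_nth])
      then show "pderiv_at i (\<lambda>x. (x$o') ^ n) x = (if i = o' then real n else 0) * (x$o') ^ (n - 1)"
        by (subst pderiv_at_eqI, assumption) (simp add: axis_def)
    qed
    then have "pderiv_at i ?f a = (if i = o' then real n else 0) * coeff_map (\<lambda>x. (x$o') ^ (n - 1)) (single o' p) a (axis o' 1)"
      by (simp only: pderiv_at_coeff_map[OF sm sum_single] coeff_map_cmult[OF sm sum_single])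
    \<comment> \<open>For n = 0 the truncated n - 1 is again n, but then the factor
      \<open>real n\<close> is 0.\<close>
    then show ?thesis
      by (cases "n = 0") (simp_all add: coeff_map_power)
  qed
  have "(?f has_derivative (\<lambda>h. 0)) (at a)" for a
  proof -
    have "?f differentiable (at a)"
      unfolding coeff_map_def
      by (intro differentiable_sym_tensor_field[OF A_range] smooth_mult_mpow_sym_tensor_field sm sum_single)
    from has_derivative_pderiv_at[OF this] show ?thesis by (simp add: pd)
  qed
  then obtain k where "\<And>a. ?f a = k"
    using has_derivative_zero_constant[of UNIV ?f] by auto
  then have "c a = k / dpow n p 1" for a
    using f[of a] dpow_top(2) by (simp add: field_simps)
  then show thesis
    by (intro that[of "k / dpow n p 1"]) (simp add: c)
qed

text \<open>Both \<open>T_op\<close> and the Taylor sum run over lists of indices, so no multinomial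
  coefficients appear and \<open>fact n\<close> is simply the Taylor denominator.\<close>

lemma A_eq_T_op:
  assumes c: "\<And>a \<alpha> \<beta>. sum \<alpha> UNIV = n \<Longrightarrow> sum \<beta> UNIV = p \<Longrightarrow>
      taylor_map a \<alpha> \<beta> = (\<lambda>\<xi>. c * dmpow \<alpha> \<beta> \<xi>)"
    and P: "P \<in> sym_tensor_fields p"
  shows "A P = (\<lambda>x \<xi>. (c / fact n) * T_op n P x \<xi>)"
proof (intro ext)
  fix x \<xi>
  obtain b where b0: "\<forall>\<beta>. smooth (b \<beta>)" and b: "P = (\<lambda>x \<xi>. \<Sum>\<beta> | sum \<beta> UNIV = p. b \<beta> x * mpow \<beta> \<xi>)"
    using P unfolding sym_tensor_fields_mpow by blast
  have sm: "smooth (b \<beta>)" for \<beta>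
    using b0 by blast
  have "A P x \<xi> = (\<Sum>\<beta> | sum \<beta> UNIV = p. coeff_map (b \<beta>) \<beta> x \<xi>)"
    unfolding b coeff_map_def
    by (subst A_sum[OF finite_multi_indices]) (auto intro: smooth_mult_mpow_sym_tensor_field sm)
  also have "\<dots> = (\<Sum>\<beta> | sum \<beta> UNIV = p.
      (\<Sum>is | length is = n. foldr pderiv_at is (b \<beta>) x * (c * dmpow (count_list is) \<beta> \<xi>)) / fact n)"
    by (intro sum.cong refl) (simp add: coeff_map_taylor[OF sm] c sum_count_list_UNIV)
  also have "\<dots> = (c / fact n) * T_op n P x \<xi>"
    unfolding b T_op_eq[OF sm]
    by (simp add: sum_distrib_left sum_divide_distrib mult_ac)
  finally show "A P x \<xi> = (c / fact n) * T_op n P x \<xi>" .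
qed

text \<open>Equivariance under x_j E on x^\<alpha> \<xi>^\<beta>, read at the origin. In the
  coefficient, n - 1 is the degree in x, - p comes from Euler's identity in \<xi> and \<delta> (m +
  1) from the divergence.\<close>

lemma quadratic_relation:
  assumes \<alpha>: "Suc (sum \<alpha> UNIV) = n" and \<beta>: "sum \<beta> UNIV = p" and pos: "\<beta> j > 0"
  shows "(real n - 1 - real p + \<delta> * (real CARD('m) + 1)) * taylor_map 0 (\<alpha>(j := Suc (\<alpha> j))) \<beta> \<xi> =
    real (\<beta> j) * (\<Sum>k\<in>UNIV. taylor_map 0 (\<alpha>(k := Suc (\<alpha> k))) (move j k \<beta>) \<xi>)"
proof -
  let ?P = "\<lambda>x \<xi>. mpow \<alpha> x * mpow \<beta> \<xi>"
  let ?e = "real n - 1 - real p + \<delta> * (real CARD('m) + 1)"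
  let ?P1 = "\<lambda>x \<xi>. mpow (\<alpha>(j := Suc (\<alpha> j))) x * mpow \<beta> \<xi>"
  let ?P2 = "\<lambda>k x \<xi>. mpow (\<alpha>(k := Suc (\<alpha> k))) x * mpow (move j k \<beta>) \<xi>"
  have sm: "smooth (mpow \<alpha>)" for \<alpha> :: "'m \<Rightarrow> nat"
    using smooth_mpow_translate[of \<alpha> 0] by simp
  have P: "?P \<in> sym_tensor_fields p"
    by (intro smooth_mult_mpow_sym_tensor_field sm \<beta>)
  have P1: "?P1 \<in> sym_tensor_fields p"
    by (intro smooth_mult_mpow_sym_tensor_field sm \<beta>)
  have P2: "?P2 k \<in> sym_tensor_fields p" for k
    using pos \<beta> by (intro smooth_mult_mpow_sym_tensor_field sm) (simp add: sum_move)
  have lie: "lie_deriv \<delta> (\<lambda>x. x$j *\<^sub>R x) ?P = (\<lambda>x \<xi>. ?e * ?P1 x \<xi> + - real (\<beta> j) * (\<Sum>k\<in>UNIV. ?P2 k x \<xi>))"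
  proof (intro ext)
    fix x \<xi>
    have 1: "(\<Sum>k\<in>UNIV. x$k * dx k ?P x \<xi>) = (real n - 1) * ?P x \<xi>"
    proof -
      have "(\<Sum>k\<in>UNIV. x$k * dx k ?P x \<xi>) = (\<Sum>k\<in>UNIV. x$k * pderiv_at k (mpow \<alpha>) x) * mpow \<beta> \<xi>"
        by (simp add: dx_smooth_mult sm sum_distrib_right mult.assoc)
      then show ?thesis
        using \<alpha> by (simp add: sum_nth_mult_pderiv_at_mpow flip: \<alpha>)
    qed
    have 2: "(\<Sum>k\<in>UNIV. \<xi>$k * pderiv_at k (?P x) \<xi>) = real p * ?P x \<xi>"
      using sum_nth_mult_pderiv_at_mpow[of \<xi> \<beta>] \<beta>
      by (simp add: pderiv_at_cmult sum_distrib_left[symmetric] mult.left_commute[of "\<xi> $ _"] mult.left_commute[of "real p"])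
    have 3: "(\<Sum>k\<in>UNIV. x$k * (\<xi>$k * pderiv_at j (?P x) \<xi>)) = real (\<beta> j) * (\<Sum>k\<in>UNIV. ?P2 k x \<xi>)"
      by (simp add: pderiv_at_cmult mult.left_commute[of "\<xi> $ _"] nth_mult_pderiv_at_mpow mpow_add_one sum_distrib_left mult_ac)
    show "lie_deriv \<delta> (\<lambda>x. x$j *\<^sub>R x) ?P x \<xi> = ?e * ?P1 x \<xi> + - real (\<beta> j) * (\<Sum>k\<in>UNIV. ?P2 k x \<xi>)"
      unfolding lie_deriv_quadratic 1 2 3 mpow_add_one by (simp add: algebra_simps)
  qed
  \<comment> \<open>Every term of the Lie derivative of \<open>A ?P\<close> carries a coordinate of
    x as a factor, hence vanishes at the origin.\<close>
  have "0 = A (lie_deriv \<delta> (\<lambda>x. x$j *\<^sub>R x) ?P) 0 \<xi>"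
    unfolding equivariant[OF quadratic_sl_field P, symmetric] lie_deriv_quadratic by simp
  also have "\<dots> = ?e * A ?P1 0 \<xi> + - real (\<beta> j) * (\<Sum>k\<in>UNIV. A (?P2 k) 0 \<xi>)"
    unfolding lie
    by (simp only: A_add[OF sym_tensor_fields_cmult[OF P1] sym_tensor_fields_cmult[OF sym_tensor_fields_sum[OF P2]]]
        A_cmult[OF P1] A_cmult[OF sym_tensor_fields_sum[OF P2]] A_sum[OF finite P2])
  finally show ?thesis
    by (simp add: taylor_map_def coeff_map_def)
qed

text \<open>Test on x_o^(n-1) \<xi>_o^p at the covector e_o. In the sum over k the index
  \<open>o'\<close> contributes K and each of the m - 1 others K/p, so that n - 1 - p + \<delta> (m
  + 1) = p + m - 1.\<close>

lemma delta_eq: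
  assumes c: "\<And>\<alpha> \<beta>. sum \<alpha> UNIV = n \<Longrightarrow> sum \<beta> UNIV = p \<Longrightarrow>
      taylor_map 0 \<alpha> \<beta> = (\<lambda>\<xi>. c * dmpow \<alpha> \<beta> \<xi>)"
    and "c \<noteq> 0" "q < p"
  shows "\<delta> = (real CARD('m) + real p + real q) / (real CARD('m) + 1)"
proof -
  obtain o' :: 'm where True by simp
  obtain l r where n: "n = Suc l" and p: "p = Suc r"
    using \<open>q < p\<close> by (cases n; cases p) auto
  have "real p \<noteq> 0"
    using p by simp
  have n': "Suc r - q = Suc l"
    using n p by simp
  let ?\<alpha> = "single o' l" and ?\<beta> = "single o' p" and ?K = "dpow n p 1"
  \<comment> \<open>For k \<noteq> \<open>o'\<close> what remains is the derivative of order n - 1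
    of t^(p-1) at 1, and K is p times this by \<open>dpow_Suc\<close>.\<close>
  have dm: "dmpow (?\<alpha>(k := Suc (?\<alpha> k))) (move o' k ?\<beta>) (axis o' 1) = (if k = o' then ?K else ?K / real p)" for k
  proof (cases "k = o'")
    case True
    then show ?thesis
      using p by (subst dmpow_axis[of o']) (auto simp: move_def n n' axis_def)
  next
    case False
    then show ?thesis
      using p by (subst dmpow_axis[of o']) (auto simp: move_def n n' axis_def dpow_Suc single_def)
  qed
  have "(real n - 1 - real p + \<delta> * (real CARD('m) + 1)) * taylor_map 0 (?\<alpha>(o' := Suc (?\<alpha> o'))) ?\<beta> (axis o' 1) =
    real (?\<beta> o') * (\<Sum>k\<in>UNIV. taylor_map 0 (?\<alpha>(k := Suc (?\<alpha> k))) (move o' k ?\<beta>) (axis o' 1))"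
    by (rule quadratic_relation) (use n p in simp_all)
  also have "?\<alpha>(o' := Suc (?\<alpha> o')) = single o' n"
    by (simp add: single_def n)
  also have "taylor_map 0 (single o' n) ?\<beta> (axis o' 1) = c * ?K"
    by (simp add: c dmpow_single)
  also have "(\<Sum>k\<in>UNIV. taylor_map 0 (?\<alpha>(k := Suc (?\<alpha> k))) (move o' k ?\<beta>) (axis o' 1)) =
      (\<Sum>k\<in>UNIV. c * (if k = o' then ?K else ?K / real p))"
  proof (rule sum.cong[OF refl])
    fix k
    have "sum (?\<alpha>(k := Suc (?\<alpha> k))) UNIV = n"
      using n by (simp only: sum_fun_upd) (simp add: sum_UNIV_split[of ?\<alpha> k, symmetric])
    moreover have "sum (move o' k ?\<beta>) UNIV = p"
      using p by (simp add: sum_move)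
    ultimately show "taylor_map 0 (?\<alpha>(k := Suc (?\<alpha> k))) (move o' k ?\<beta>) (axis o' 1) =
        c * (if k = o' then ?K else ?K / real p)"
      by (simp only: c dm)
  qed
  also have "\<dots> = c * (?K + (real CARD('m) - 1) * (?K / real p))"
  proof -
    have "(\<Sum>k\<in>UNIV - {o'}. if k = o' then ?K else ?K / real p) = (\<Sum>k\<in>UNIV - {o'}. ?K / real p)"
      by (rule sum.cong) auto
    moreover have "real (card (UNIV - {o'})) = real CARD('m) - 1"
      by (simp add: card_Diff_singleton of_nat_diff Suc_leI)
    ultimately show ?thesis
      unfolding sum_distrib_left[symmetric] by (simp add: sum_UNIV_split[of _ o'])
  qed
  also have "real (?\<beta> o') * (c * (?K + (real CARD('m) - 1) * (?K / real p))) =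
      (real p + real CARD('m) - 1) * (c * ?K)"
  proof -
    have "P * (c * (K + (M - 1) * (K / P))) = (P + M - 1) * (c * K)" if "P \<noteq> 0" for P K M :: real
      using that by (simp add: field_simps)
    with \<open>real p \<noteq> 0\<close> show ?thesis
      by simp
  qed
  finally have "real n - 1 - real p + \<delta> * (real CARD('m) + 1) = real p + real CARD('m) - 1"
    using \<open>c \<noteq> 0\<close> dpow_top(2) by (simp only: mult_cancel_right) simp
  then have "\<delta> * (real CARD('m) + 1) = real CARD('m) + real p + real q"
    using q_le_p by (simp add: of_nat_diff)
  then show ?thesis
    by (simp add: field_simps add_pos_nonneg)
qed

end

theorem theorem7p2:
  fixes \<delta> :: real and p q :: nat
    and A :: "'m::finite tensor_field \<Rightarrow> 'm tensor_field"
  assumes "p \<ge> q"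
    and "linear_between (sym_tensor_fields p) (sym_tensor_fields q) A"
    and "\<forall>X\<in>sl_fields. \<forall>P\<in>sym_tensor_fields p.
           lie_deriv \<delta> X (A P) = A (lie_deriv \<delta> X P)"
    and "\<exists>P\<in>sym_tensor_fields p. A P \<noteq> (\<lambda>x \<xi>. 0)"
  shows "(p = q \<and> (\<exists>c. \<forall>P\<in>sym_tensor_fields p. A P = (\<lambda>x \<xi>. c * P x \<xi>))) \<or>
    (p > q \<and> \<delta> = (real CARD('m) + real p + real q) / (real CARD('m) + 1) \<and>
     (\<exists>c. \<forall>P\<in>sym_tensor_fields p. A P = (\<lambda>x \<xi>. c * T_op (p - q) P x \<xi>)))"
proof -
  interpret sl_equivariant A \<delta> p q
    using assms(1-3) by unfold_locales auto
  obtain c where c: "\<And>a \<alpha> \<beta>. sum \<alpha> UNIV = p - q \<Longrightarrow> sum \<beta> UNIV = p \<Longrightarrow>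
      taylor_map a \<alpha> \<beta> = (\<lambda>\<xi>. c * dmpow \<alpha> \<beta> \<xi>)"
    using taylor_map_const by metis
  note A = A_eq_T_op[OF c]
  from A assms(4) have "c \<noteq> 0" by auto
  show ?thesis
  proof (cases "p = q")
    case True
    then show ?thesis using A by auto
  next
    case False
    with assms(1) have "q < p" by simp
    with delta_eq[OF c \<open>c \<noteq> 0\<close>] A show ?thesis by blast
  qed
qed

end
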